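(* Let $(X,\Sigma,\mu)$ be a complete $\sigma$-finite measure space, $\mathcal{A}\subseteq\Sigma$ a sub-$\sigma$-finite algebra, $E=E^{\mathcal{A}}$ the associated conditional expectation, and $u,w\in\mathcal{D}(E)$ such that $T=M_wEM_u$ is a bounded operator on $L^2(\Sigma)$. Let $S=S(E(|u|^2))$ and $S'=S(E(u))$. Then: (a) If $|E(uw)|^2\geq E(|u|^2)E(|w|^2)$ on $S$, then $T$ belongs to the $A$-class. (b) If $T$ belongs to the $A$-class, then $|E(uw)|^2\geq E(|u|^2)E(|w|^2)$ on $S'$. (c) If $S=S'$, then $T$ belongs to the $A$-class if and only if $|E(uw)|^2\geq E(|u|^2)E(|w|^2)$ on $S$.
   Context: For a sub-$\sigma$-finite algebra $\mathcal{A}\subseteq\Sigma$, $E=E^{\mathcal{A}}$ denotes the conditional expectation: for $f\geq 0$ measurable or $f\in L^2(\Sigma)$, $Ef$ is the unique $\mathcal{A}$-measurable function with $\int_A f\,d\mu=\int_A Ef\,d\mu$ for all $A\in\mathcal{A}$. $\mathcal{D}(E)=\{g\in L^0(\Sigma): E(|g|)\in L^0(\mathcal{A})\}$, where $L^0$ denotes a.e. finite measurable functions. $M_w$ is multiplication by $w$, so $M_wEM_u f=wE(uf)$. The support of $f$ is $S(f)=\{x: f(x)\neq 0\}$. All comparisons between functions or sets hold up to $\mu$-null sets. For a bounded operator $T$ on a Hilbert space, $|T|=(T^*T)^{1/2}$; $T$ belongs to the $A$-class if $|T|^2\leq |T^2|$ (as positive operators). *)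

theory Defs
  imports "HOL-Probability.Probability"
begin

text \<open>Conditional expectation of a complex-valued function: componentwise real
conditional expectation (which, for real functions, is defined for every g with
E(abs g) finite a.e. as E(g+) - E(g-), via the nonnegative conditional expectation).\<close>
definition cexp :: "'a measure \<Rightarrow> 'a measure \<Rightarrow> ('a \<Rightarrow> complex) \<Rightarrow> ('a \<Rightarrow> complex)" where
  "cexp M F f = (\<lambda>x. Complex (real_cond_exp M F (\<lambda>y. Re (f y)) x)
                               (real_cond_exp M F (\<lambda>y. Im (f y)) x))"

definition domE :: "'a measure \<Rightarrow> 'a measure \<Rightarrow> ('a \<Rightarrow> complex) set" where
  "domE M F = {g. g \<in> borel_measurable M \<and>
      (AE x in M. nn_cond_exp M F (\<lambda>y. ennreal (cmod (g y))) x \<noteq> \<infinity>)}"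

definition Esq :: "'a measure \<Rightarrow> 'a measure \<Rightarrow> ('a \<Rightarrow> complex) \<Rightarrow> ('a \<Rightarrow> ennreal)" where
  "Esq M F u = nn_cond_exp M F (\<lambda>y. ennreal ((cmod (u y))\<^sup>2))"

definition condop :: "'a measure \<Rightarrow> 'a measure \<Rightarrow> ('a \<Rightarrow> complex) \<Rightarrow> ('a \<Rightarrow> complex)
    \<Rightarrow> ('a \<Rightarrow> complex) \<Rightarrow> ('a \<Rightarrow> complex)" where
  "condop M F u w = (\<lambda>f x. w x * cexp M F (\<lambda>y. u y * f y) x)"

section \<open>L^2 and bounded operators (elements represented by functions, modulo a.e. equality)\<close>

definition L2 :: "'a measure \<Rightarrow> ('a \<Rightarrow> complex) set" where
  "L2 M = {f \<in> borel_measurable M. integrable M (\<lambda>x. (cmod (f x))\<^sup>2)}"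

definition l2_inner :: "'a measure \<Rightarrow> ('a \<Rightarrow> complex) \<Rightarrow> ('a \<Rightarrow> complex) \<Rightarrow> complex" where
  "l2_inner M f g = (LINT x|M. f x * cnj (g x))"

definition l2_norm :: "'a measure \<Rightarrow> ('a \<Rightarrow> complex) \<Rightarrow> real" where
  "l2_norm M f = sqrt (LINT x|M. (cmod (f x))\<^sup>2)"

type_synonym 'a op = "('a \<Rightarrow> complex) \<Rightarrow> ('a \<Rightarrow> complex)"

definition bounded_op :: "'a measure \<Rightarrow> 'a op \<Rightarrow> bool" where
  "bounded_op M T \<longleftrightarrow>
     (\<forall>f\<in>L2 M. T f \<in> L2 M) \<and>
     (\<forall>f\<in>L2 M. \<forall>g\<in>L2 M. (AE x in M. f x = g x) \<longrightarrow> (AE x in M. T f x = T g x)) \<and>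
     (\<forall>f\<in>L2 M. \<forall>g\<in>L2 M. \<forall>c::complex.
        AE x in M. T (\<lambda>y. c * f y + g y) x = c * T f x + T g x) \<and>
     (\<exists>C. \<forall>f\<in>L2 M. l2_norm M (T f) \<le> C * l2_norm M f)"

definition op_eq :: "'a measure \<Rightarrow> 'a op \<Rightarrow> 'a op \<Rightarrow> bool" where
  "op_eq M S T \<longleftrightarrow> (\<forall>f\<in>L2 M. AE x in M. S f x = T f x)"

definition is_adjoint :: "'a measure \<Rightarrow> 'a op \<Rightarrow> 'a op \<Rightarrow> bool" where
  "is_adjoint M T S \<longleftrightarrow> bounded_op M S \<and>
     (\<forall>f\<in>L2 M. \<forall>g\<in>L2 M. l2_inner M (T f) g = l2_inner M f (S g))"

definition adjoint :: "'a measure \<Rightarrow> 'a op \<Rightarrow> 'a op" where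
  "adjoint M T = (SOME S. is_adjoint M T S)"

definition positive_op :: "'a measure \<Rightarrow> 'a op \<Rightarrow> bool" where
  "positive_op M P \<longleftrightarrow> bounded_op M P \<and>
     (\<forall>f\<in>L2 M. Im (l2_inner M (P f) f) = 0 \<and> Re (l2_inner M (P f) f) \<ge> 0)"

definition op_le :: "'a measure \<Rightarrow> 'a op \<Rightarrow> 'a op \<Rightarrow> bool" where
  "op_le M P Q \<longleftrightarrow> positive_op M (\<lambda>f x. Q f x - P f x)"

definition op_sqrt :: "'a measure \<Rightarrow> 'a op \<Rightarrow> 'a op" where
  "op_sqrt M P = (SOME R. positive_op M R \<and> op_eq M (R \<circ> R) P)"

definition op_abs :: "'a measure \<Rightarrow> 'a op \<Rightarrow> 'a op" where
  "op_abs M T = op_sqrt M (adjoint M T \<circ> T)"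

definition A_class :: "'a measure \<Rightarrow> 'a op \<Rightarrow> bool" where
  "A_class M T \<longleftrightarrow> op_le M (op_abs M T \<circ> op_abs M T) (op_abs M (T \<circ> T))"

end

theory Submission
  imports Defs
begin

text \<open>
  Write K = E(|u|^2) and L = E(|w|^2). Testing boundedness of T against truncations of cnj u shows
  K L \<open>\<le>\<close> C^2, so that T = v E(cnj e \<open>\<cdot>\<close>) with e = cnj u / sqrt K and v = w sqrt K, where E(|e|^2) is
  0 or 1 and s^2 = E(|v|^2) = K L is bounded. For operators of this shape everything is explicit: |T|^2 is
  s^2 e E(cnj e \<open>\<cdot>\<close>), and since T^2 = b v E(cnj e \<open>\<cdot>\<close>) with b = E(v cnj e), |T^2| is |b| s e E(cnj e \<open>\<cdot>\<close>). Both are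
  multiples of the same projection, so T is in the A-class if and only if s^2 \<open>\<le>\<close> |b| s almost everywhere,
  that is K L \<open>\<le>\<close> |E(uw)|^2. Off the support of K both sides are harmless, so all three claims follow
  from this single equivalence.
\<close>

section \<open>Uniqueness of positive square roots\<close>

text \<open>K and L need not be bounded, or even finite, separately; only K L is. So f -> E(u f) and
  h -> w h may each be unbounded on L^2, and shifting the factor sqrt K from u to w makes both
  factors bounded. The gain is that P = e E(cnj e .) is then an orthogonal projection that commutes
  with multiplication by F-measurable functions, so the root of s^2 P is s P and functional calculus
  becomes a pointwise root. The obstacle is that \<open>adjoint\<close> and \<open>op_sqrt\<close>
  are choices by \<open>SOME\<close> on functions that are not identified modulo null sets. A
  formula for |T| can be transferred to \<open>op_abs\<close> only by proving that positive square
  roots agree almost everywhere. This is done with real scalars in a semi-definite space, by a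
  numerical-radius argument that uses neither completeness nor spectral theory. The order of the
  multipliers is recovered from the quadratic forms by testing on e times the indicator of an
  F-measurable set A: there E(cnj e f) is the indicator of A wherever E(|e|^2) = 1.\<close>

locale semi_inner_space =
  fixes V :: "'v set" and lc :: "real \<Rightarrow> 'v \<Rightarrow> 'v \<Rightarrow> 'v" and ip :: "'v \<Rightarrow> 'v \<Rightarrow> real"
  assumes lc_closed: "\<lbrakk>f \<in> V; g \<in> V\<rbrakk> \<Longrightarrow> lc t f g \<in> V"
    and ip_lc: "\<lbrakk>f \<in> V; g \<in> V; h \<in> V\<rbrakk> \<Longrightarrow> ip (lc t f g) h = t * ip f h + ip g h"
    and ip_sym: "\<lbrakk>f \<in> V; g \<in> V\<rbrakk> \<Longrightarrow> ip f g = ip g f"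
    and ip_nonneg: "f \<in> V \<Longrightarrow> ip f f \<ge> 0"
begin

lemma ip_lc_right: "\<lbrakk>f \<in> V; g \<in> V; h \<in> V\<rbrakk> \<Longrightarrow> ip h (lc t f g) = t * ip h f + ip h g"
  using ip_lc ip_sym lc_closed by metis

lemma ip_lc_self:
  assumes "f \<in> V" "g \<in> V"
  shows "ip (lc t f g) (lc t f g) = t\<^sup>2 * ip f f + 2 * t * ip f g + ip g g"
  using assms by (simp add: ip_lc ip_lc_right lc_closed ip_sym[of g f] power2_eq_square algebra_simps)

lemma ip_Cauchy_Schwarz:
  assumes f: "f \<in> V" and g: "g \<in> V"
  shows "(ip f g)\<^sup>2 \<le> ip f f * ip g g"
proof (cases "ip f f = 0")
  case True
  have "ip f g = 0"
  proof (rule ccontr)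
    assume nz: "ip f g \<noteq> 0"
    \<comment> \<open>For \<open>ip f f = 0\<close> the quadratic in \<open>t\<close> degenerates to
      an affine function; this choice gives it the value -1, which semi-definiteness
      forbids.\<close>
    define t where "t = - (ip g g + 1) / (2 * ip f g)"
    have "ip (lc t f g) (lc t f g) = -1"
      unfolding ip_lc_self[OF f g] True t_def using nz by (simp add: field_simps)
    with ip_nonneg[OF lc_closed[OF f g, of t]] show False by simp
  qed
  then show ?thesis using True by simp
next
  case False
  then have pos: "ip f f > 0" using ip_nonneg[OF f] by simp
  define t where "t = - ip f g / ip f f"
  have "0 \<le> ip (lc t f g) (lc t f g)" by (intro ip_nonneg lc_closed f g)
  also have "\<dots> = ip g g - (ip f g)\<^sup>2 / ip f f"
    unfolding ip_lc_self[OF f g] t_def using pos by (simp add: field_simps power2_eq_square)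
  finally show ?thesis using pos by (simp add: field_simps)
qed

text \<open>Linearity is required only after pairing with a vector: operators on L^2 are linear only
  up to null sets, and \<open>ip\<close> does not see such differences. Symmetry is a clause of its
  own because over real scalars it does not follow from positivity.\<close>

definition pos_bdd :: "('v \<Rightarrow> 'v) \<Rightarrow> bool" where
  "pos_bdd A \<longleftrightarrow> (\<forall>f\<in>V. A f \<in> V) \<and>
     (\<forall>f\<in>V. \<forall>g\<in>V. \<forall>h\<in>V. \<forall>t. ip (A (lc t f g)) h = t * ip (A f) h + ip (A g) h) \<and>
     (\<forall>f\<in>V. \<forall>g\<in>V. ip (A f) g = ip f (A g)) \<and>
     (\<forall>f\<in>V. ip (A f) f \<ge> 0) \<and>
     (\<exists>C. \<forall>f\<in>V. ip (A f) (A f) \<le> C * ip f f)"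

text \<open>Polarisation: the quadratic form of \<open>X\<close> at v + t X v and at v - t X v
  differs by 4 t |Xv|^2, while in the sum of the two squared norms the mixed terms cancel.\<close>

lemma norm_le_numerical_radius:
  assumes X: "\<And>f. f \<in> V \<Longrightarrow> X f \<in> V"
    and lin: "\<And>f g h t. \<lbrakk>f \<in> V; g \<in> V; h \<in> V\<rbrakk> \<Longrightarrow> ip (X (lc t f g)) h = t * ip (X f) h + ip (X g) h"
    and sym: "\<And>f g. \<lbrakk>f \<in> V; g \<in> V\<rbrakk> \<Longrightarrow> ip (X f) g = ip f (X g)"
    and l: "l > 0" and rad: "\<And>f. f \<in> V \<Longrightarrow> \<bar>ip (X f) f\<bar> \<le> l * ip f f"
    and v: "v \<in> V"
  shows "ip (X v) (X v) \<le> l\<^sup>2 * ip v v"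
proof -
  have Q: "ip (X (lc t (X v) v)) (lc t (X v) v)
      = t\<^sup>2 * ip (X (X v)) (X v) + 2 * t * ip (X v) (X v) + ip (X v) v" for t
    using v by (simp add: ip_lc_right lin X lc_closed sym[of "X v" v] power2_eq_square algebra_simps)
  have R: "ip (lc t (X v) v) (lc t (X v) v) = t\<^sup>2 * ip (X v) (X v) + 2 * t * ip (X v) v + ip v v" for t
    using v X by (simp add: ip_lc_self)
  have b: "\<bar>ip (X (lc t (X v) v)) (lc t (X v) v)\<bar> \<le> l * ip (lc t (X v) v) (lc t (X v) v)" for t
    by (intro rad lc_closed X v)
  \<comment> \<open>Difference of the two bounds at \<open>t = 1/l\<close> and
    \<open>t = -(1/l)\<close>. For this \<open>t\<close> the term with \<open>ip (X v) (X v)\<close>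
    on the right is exactly half of the left side and can be absorbed.\<close>
  have "4 * (1/l) * ip (X v) (X v) \<le> l * (2 * (1/l)\<^sup>2 * ip (X v) (X v) + 2 * ip v v)"
    using b[of "1/l"] b[of "-(1/l)"] unfolding Q R by (simp add: algebra_simps)
  also have "\<dots> = 2 * (1/l) * ip (X v) (X v) + 2 * l * ip v v"
    using l by (simp add: field_simps power2_eq_square)
  finally have "(1/l) * ip (X v) (X v) \<le> l * ip v v" by simp
  then show ?thesis using l by (simp add: field_simps power2_eq_square)
qed

text \<open>With X = A - R and S = A + R one has Re (Xv, Sv) = 0 and |(Xv, v)| \<open>\<le>\<close> (Sv, v). A vector
  that almost attains the numerical radius of X is almost an eigenvector of X, so both facts
  together force the numerical radius to vanish.\<close>

theorem pos_sqrt_unique: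
  assumes A: "pos_bdd A" and R: "pos_bdd R"
    and eq: "\<And>f g. \<lbrakk>f \<in> V; g \<in> V\<rbrakk> \<Longrightarrow> ip (A (A f)) g = ip (R (R f)) g"
    and v: "v \<in> V"
  shows "ip (lc (-1) (R v) (A v)) (lc (-1) (R v) (A v)) = 0"
proof -
  have AV: "\<And>f. f \<in> V \<Longrightarrow> A f \<in> V" and RV: "\<And>f. f \<in> V \<Longrightarrow> R f \<in> V"
    and Alin: "\<And>f g h t. \<lbrakk>f \<in> V; g \<in> V; h \<in> V\<rbrakk> \<Longrightarrow> ip (A (lc t f g)) h = t * ip (A f) h + ip (A g) h"
    and Rlin: "\<And>f g h t. \<lbrakk>f \<in> V; g \<in> V; h \<in> V\<rbrakk> \<Longrightarrow> ip (R (lc t f g)) h = t * ip (R f) h + ip (R g) h"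
    and Asym: "\<And>f g. \<lbrakk>f \<in> V; g \<in> V\<rbrakk> \<Longrightarrow> ip (A f) g = ip f (A g)"
    and Rsym: "\<And>f g. \<lbrakk>f \<in> V; g \<in> V\<rbrakk> \<Longrightarrow> ip (R f) g = ip f (R g)"
    and Apos: "\<And>f. f \<in> V \<Longrightarrow> ip (A f) f \<ge> 0" and Rpos: "\<And>f. f \<in> V \<Longrightarrow> ip (R f) f \<ge> 0"
    using A R unfolding pos_bdd_def by blast+
  obtain CA CR where CA: "\<And>f. f \<in> V \<Longrightarrow> ip (A f) (A f) \<le> CA * ip f f"
    and CR: "\<And>f. f \<in> V \<Longrightarrow> ip (R f) (R f) \<le> CR * ip f f"
    using A R unfolding pos_bdd_def by metis
  define X where "X f = lc (-1) (R f) (A f)" for f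
  define S where "S f = lc 1 (R f) (A f)" for f
  have XV: "X f \<in> V" and SV: "S f \<in> V" if "f \<in> V" for f
    using that by (auto simp: X_def S_def lc_closed AV RV)
  have ipX: "ip (X f) g = ip (A f) g - ip (R f) g" if "f \<in> V" "g \<in> V" for f g
    using that by (simp add: X_def ip_lc AV RV)
  have ipS: "ip (S f) g = ip (A f) g + ip (R f) g" if "f \<in> V" "g \<in> V" for f g
    using that by (simp add: S_def ip_lc AV RV)
  have Xlin: "ip (X (lc t f g)) h = t * ip (X f) h + ip (X g) h" if "f \<in> V" "g \<in> V" "h \<in> V" for f g h t
    using that by (simp add: ipX lc_closed Alin Rlin algebra_simps)
  have Xsym: "ip (X f) g = ip f (X g)" if "f \<in> V" "g \<in> V" for f g
    using that by (simp add: ipX ip_sym[of f "X g"] XV Asym Rsym ip_sym[of f "A g"] ip_sym[of f "R g"] AV RV)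
  \<comment> \<open>The mixed terms cancel by symmetry of \<open>ip\<close>; what remains compares
    the two equal squares.\<close>
  have XS: "ip (X f) (S f) = 0" if "f \<in> V" for f
  proof -
    have "ip (X f) (S f) = ip (A f) (A f) - ip (R f) (R f)"
      using that by (simp add: ipX S_def ip_lc_right AV RV lc_closed ip_sym[of "R f" "A f"])
    also have "\<dots> = ip (A (A f)) f - ip (R (R f)) f" using that by (simp add: Asym Rsym AV RV)
    finally show ?thesis using eq that by simp
  qed
  have XleS: "\<bar>ip (X f) f\<bar> \<le> ip (S f) f" if "f \<in> V" for f
    using that Apos[of f] Rpos[of f] by (simp add: ipX ipS)
  \<comment> \<open>\<open>D\<close> bounds the squared norm of \<open>S\<close> through the
    parallelogram law for \<open>S\<close> and \<open>X\<close>. Absolute values are taken because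
    \<open>CA\<close> and \<open>CR\<close> may be negative when \<open>ip\<close> vanishes; the
    summand 1 makes \<open>D\<close> positive, so that it can be a divisor below.\<close>
  define D where "D = 2 * (\<bar>CA\<bar> + \<bar>CR\<bar>) + 1"
  have D: "D > 0" unfolding D_def by simp
  have SD: "ip (S f) (S f) \<le> D * ip f f" if f: "f \<in> V" for f
  proof -
    have "ip (S f) (S f) + ip (X f) (X f) = 2 * ip (A f) (A f) + 2 * ip (R f) (R f)"
      using f by (simp add: S_def X_def ip_lc_self AV RV)
    moreover have "ip (X f) (X f) \<ge> 0" by (intro ip_nonneg XV f)
    moreover have "CA * ip f f \<le> \<bar>CA\<bar> * ip f f" "CR * ip f f \<le> \<bar>CR\<bar> * ip f f"
      using ip_nonneg[OF f] by (simp_all add: mult_right_mono)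
    moreover have "D * ip f f = 2 * (\<bar>CA\<bar> * ip f f) + 2 * (\<bar>CR\<bar> * ip f f) + ip f f"
      unfolding D_def by (simp add: algebra_simps)
    ultimately show ?thesis using CA[OF f] CR[OF f] ip_nonneg[OF f] by linarith
  qed
  have rad2: "(ip (X f) f)\<^sup>2 \<le> D * (ip f f)\<^sup>2" if f: "f \<in> V" for f
  proof -
    have "(ip (X f) f)\<^sup>2 \<le> (ip (S f) f)\<^sup>2"
      using power_mono[OF XleS[OF f], of 2] by simp
    also have "\<dots> \<le> ip (S f) (S f) * ip f f" by (intro ip_Cauchy_Schwarz SV f)
    also have "\<dots> \<le> D * ip f f * ip f f" by (intro mult_right_mono SD f ip_nonneg)
    finally show ?thesis by (simp add: power2_eq_square mult.assoc)
  qed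
  \<comment> \<open>Squared Rayleigh quotients of \<open>X\<close>; their supremum \<open>m\<close>
    is the square of the numerical radius. The element 0 keeps the set nonempty when all vectors
    have norm 0.\<close>
  define T where "T = insert 0 {(ip (X f) f)\<^sup>2 / (ip f f)\<^sup>2 |f. f \<in> V \<and> ip f f \<noteq> 0}"
  have bdd: "bdd_above T"
  proof (rule bdd_aboveI)
    fix t assume "t \<in> T"
    then show "t \<le> D" using rad2 D by (auto simp: T_def divide_le_eq)
  qed
  define m where "m = Sup T"
  have upper: "t \<le> m" if "t \<in> T" for t unfolding m_def by (rule cSup_upper[OF that bdd])
  have m0: "m \<ge> 0" by (rule upper) (simp add: T_def)
  have radm: "\<bar>ip (X f) f\<bar> \<le> l * ip f f" if f: "f \<in> V" and l: "l \<ge> sqrt m" for f l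
  proof (cases "ip f f = 0")
    case True
    then show ?thesis using rad2[OF f] by simp
  next
    case False
    then have "(ip (X f) f)\<^sup>2 / (ip f f)\<^sup>2 \<le> m" using f by (intro upper) (auto simp: T_def)
    then have "(ip (X f) f)\<^sup>2 \<le> m * (ip f f)\<^sup>2" using False by (simp add: divide_le_eq)
    then have "sqrt ((ip (X f) f)\<^sup>2) \<le> sqrt (m * (ip f f)\<^sup>2)" by (rule real_sqrt_le_mono)
    then have "\<bar>ip (X f) f\<bar> \<le> sqrt m * ip f f"
      using ip_nonneg[OF f] by (simp add: real_sqrt_mult)
    also have "\<dots> \<le> l * ip f f" using l ip_nonneg[OF f] by (rule mult_right_mono)
    finally show ?thesis .
  qed
  have nrm: "ip (X f) (X f) \<le> l\<^sup>2 * ip f f" if f: "f \<in> V" and l: "l > 0" "l \<ge> sqrt m" for f l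
    by (rule norm_le_numerical_radius[of X, OF XV Xlin Xsym l(1) radm f]) (use l in auto)
  \<comment> \<open>The key estimate. The residue \<open>y\<close> = X f - mu f has squared norm at
    most (m - t) n. Since X f is orthogonal to S f, pairing \<open>y\<close> with S f leaves -mu (f,
    S f), and (f, S f) is at least |mu| n. Cauchy-Schwarz for \<open>y\<close> and S f then gives
    the bound.\<close>
  have quad: "t\<^sup>2 \<le> D * (m - t)" if t: "t \<in> T" and m: "m > 0" for t
  proof (cases "t = 0")
    case True
    then show ?thesis using D m by simp
  next
    case False
    then obtain f where f: "f \<in> V" and nz: "ip f f \<noteq> 0" and teq: "t = (ip (X f) f)\<^sup>2 / (ip f f)\<^sup>2"
      using t unfolding T_def by auto
    define n where "n = ip f f"
    have n: "n > 0" using nz ip_nonneg[OF f] by (simp add: n_def)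
    define mu where "mu = ip (X f) f / n"
    have tm: "t = mu\<^sup>2" unfolding teq mu_def n_def by (simp add: power_divide)
    have Xf: "ip (X f) f = mu * n" unfolding mu_def using n by simp
    define y where "y = lc (- mu) f (X f)"
    have yV: "y \<in> V" unfolding y_def by (intro lc_closed XV f)
    have "ip y y = ip (X f) (X f) - mu\<^sup>2 * n"
      unfolding y_def ip_lc_self[OF f XV[OF f]]
      using Xf ip_sym[OF f XV[OF f]] by (simp add: n_def power2_eq_square algebra_simps)
    also have "\<dots> \<le> (sqrt m)\<^sup>2 * n - mu\<^sup>2 * n"
      using nrm[OF f, of "sqrt m"] m by (simp add: n_def)
    also have "\<dots> = (m - t) * n" using m by (simp add: tm algebra_simps)
    finally have yy: "ip y y \<le> (m - t) * n" .
    have "ip y (S f) = - mu * ip f (S f)"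
      unfolding y_def using f XS[OF f] by (simp add: ip_lc XV SV)
    then have "(mu * ip f (S f))\<^sup>2 \<le> ip y y * ip (S f) (S f)"
      using ip_Cauchy_Schwarz[OF yV SV[OF f]] by (simp add: power_mult_distrib)
    also have "\<dots> \<le> ((m - t) * n) * (D * n)"
      using yy SD[OF f] upper[OF t] n
      by (intro mult_mono) (auto simp: n_def ip_nonneg SV f)
    finally have 1: "(mu * ip f (S f))\<^sup>2 \<le> D * (m - t) * n\<^sup>2" by (simp add: power2_eq_square algebra_simps)
    have "\<bar>mu\<bar> * n \<le> ip f (S f)"
      using XleS[OF f] n unfolding Xf by (simp add: abs_mult ip_sym[OF f SV[OF f]])
    then have "(\<bar>mu\<bar> * n)\<^sup>2 \<le> (ip f (S f))\<^sup>2" using n by (intro power_mono) auto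
    then have "mu\<^sup>2 * (mu\<^sup>2 * n\<^sup>2) \<le> mu\<^sup>2 * (ip f (S f))\<^sup>2"
      by (intro mult_left_mono) (auto simp: power_mult_distrib)
    then have "t\<^sup>2 * n\<^sup>2 \<le> D * (m - t) * n\<^sup>2"
      using 1 by (simp add: tm power_mult_distrib power2_eq_square algebra_simps)
    then show ?thesis using n by simp
  qed
  have "m = 0"
  proof (rule ccontr)
    assume "m \<noteq> 0"
    then have m: "m > 0" using m0 by simp
    \<comment> \<open>For t > m - e the first bound gives t^2 \<ge> m^2/4, while the second and
      \<open>quad\<close> give t^2 \<le> m^2/8.\<close>
    define e where "e = min (m/2) (m\<^sup>2 / (8 * D))"
    have e: "e > 0" "e \<le> m/2" "e \<le> m\<^sup>2 / (8 * D)" using m D by (auto simp: e_def)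
    have "m - e < Sup T" using e unfolding m_def by simp
    then obtain t where t: "t \<in> T" "m - e < t"
      by (rule less_cSupE) (auto simp: T_def)
    have "(m/2)\<^sup>2 \<le> t\<^sup>2" using e t m by (intro power_mono) auto
    also have "\<dots> \<le> D * (m - t)" by (rule quad[OF t(1) m])
    also have "\<dots> \<le> D * e" using D t by (intro mult_left_mono) auto
    also have "\<dots> \<le> m\<^sup>2 / 8" using e(3) D by (simp add: field_simps)
    finally show False using m by (simp add: field_simps)
  qed
  then have small: "ip (X v) (X v) \<le> l\<^sup>2 * ip v v" if "l > 0" for l
    using nrm[OF v that] that by simp
  have "ip (X v) (X v) \<le> 0"
  proof (rule field_le_epsilon)
    fix e :: real assume e: "e > 0"
    \<comment> \<open>\<open>norm_le_numerical_radius\<close> needs \<open>l > 0\<close>, so the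
      radius 0 is reached as a limit; \<open>ip v v + 1\<close> guards against division by
      0.\<close>
    define l where "l = sqrt (e / (ip v v + 1))"
    have p: "e / (ip v v + 1) > 0" using e ip_nonneg[OF v] by simp
    have "ip (X v) (X v) \<le> e / (ip v v + 1) * ip v v" using small[of l] p by (simp add: l_def)
    also have "\<dots> \<le> e" using e ip_nonneg[OF v] by (simp add: field_simps)
    finally show "ip (X v) (X v) \<le> 0 + e" by simp
  qed
  then have "ip (X v) (X v) = 0" using ip_nonneg[OF XV[OF v]] by simp
  then show ?thesis by (simp add: X_def)
qed

end

section \<open>Operators on square-integrable functions\<close>

lemma borel_measurable_cnj [measurable (raw)]:
  "f \<in> borel_measurable M \<Longrightarrow> (\<lambda>x. cnj (f x)) \<in> borel_measurable M"
  using borel_measurable_continuous_onI[OF continuous_on_cnj[OF continuous_on_id]]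
  by (rule measurable_compose[rotated])

lemma L2_measurable [measurable_dest]: "f \<in> L2 M \<Longrightarrow> f \<in> borel_measurable M"
  by (simp add: L2_def)

lemma L2_iff_nn:
  "f \<in> L2 M \<longleftrightarrow> f \<in> borel_measurable M \<and> (\<integral>\<^sup>+x. ennreal ((cmod (f x))\<^sup>2) \<partial>M) < \<infinity>"
  unfolding L2_def by (auto simp: integrable_iff_bounded)

lemma L2_nn_integral:
  "f \<in> L2 M \<Longrightarrow> (\<integral>\<^sup>+x. ennreal ((cmod (f x))\<^sup>2) \<partial>M) = ennreal ((l2_norm M f)\<^sup>2)"
  unfolding L2_def l2_norm_def by (subst nn_integral_eq_integral) (auto simp: integral_nonneg_AE)

lemma L2_integrable_mult:
  assumes "f \<in> L2 M" "g \<in> L2 M"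
  shows "integrable M (\<lambda>x. f x * cnj (g x))"
proof (rule Bochner_Integration.integrable_bound)
  show "integrable M (\<lambda>x. (cmod (f x))\<^sup>2 + (cmod (g x))\<^sup>2)"
    using assms by (auto simp: L2_def)
  show "(\<lambda>x. f x * cnj (g x)) \<in> borel_measurable M"
    using assms[THEN L2_measurable] by measurable
  show "AE x in M. norm (f x * cnj (g x)) \<le> norm ((cmod (f x))\<^sup>2 + (cmod (g x))\<^sup>2)"
  proof (rule AE_I2)
    fix x
    have "2 * (cmod (f x) * cmod (g x)) \<le> (cmod (f x))\<^sup>2 + (cmod (g x))\<^sup>2"
      using sum_squares_bound[of "cmod (f x)" "cmod (g x)"] by simp
    then have "cmod (f x) * cmod (g x) \<le> (cmod (f x))\<^sup>2 + (cmod (g x))\<^sup>2"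
      using mult_nonneg_nonneg[OF norm_ge_zero[of "f x"] norm_ge_zero[of "g x"]] by linarith
    then show "norm (f x * cnj (g x)) \<le> norm ((cmod (f x))\<^sup>2 + (cmod (g x))\<^sup>2)"
      by (simp add: norm_mult)
  qed
qed

lemma L2_linear:
  assumes "f \<in> L2 M" "g \<in> L2 M"
  shows "(\<lambda>x. c * f x + g x) \<in> L2 M"
proof -
  have [measurable]: "f \<in> borel_measurable M" "g \<in> borel_measurable M"
    using assms by (auto simp: L2_def)
  have "integrable M (\<lambda>x. (cmod (c * f x + g x))\<^sup>2)"
  proof (rule Bochner_Integration.integrable_bound)
    show "integrable M (\<lambda>x. 2 * (cmod c)\<^sup>2 * (cmod (f x))\<^sup>2 + 2 * (cmod (g x))\<^sup>2)"
      using assms by (auto simp: L2_def)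
    show "AE x in M. norm ((cmod (c * f x + g x))\<^sup>2)
        \<le> norm (2 * (cmod c)\<^sup>2 * (cmod (f x))\<^sup>2 + 2 * (cmod (g x))\<^sup>2)"
    proof (rule AE_I2)
      fix x
      have "(cmod (c * f x + g x))\<^sup>2 \<le> (cmod c * cmod (f x) + cmod (g x))\<^sup>2"
        by (intro power_mono) (metis norm_mult norm_triangle_ineq, simp)
      also have "\<dots> \<le> 2 * (cmod c * cmod (f x))\<^sup>2 + 2 * (cmod (g x))\<^sup>2"
        using sum_squares_bound[of "cmod c * cmod (f x)" "cmod (g x)"]
        by (simp add: power2_eq_square algebra_simps)
      finally show "norm ((cmod (c * f x + g x))\<^sup>2)
        \<le> norm (2 * (cmod c)\<^sup>2 * (cmod (f x))\<^sup>2 + 2 * (cmod (g x))\<^sup>2)"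
        by (simp add: power_mult_distrib)
    qed
  qed measurable
  then show ?thesis by (simp add: L2_def)
qed

lemma L2_diff: "f \<in> L2 M \<Longrightarrow> g \<in> L2 M \<Longrightarrow> (\<lambda>x. f x - g x) \<in> L2 M"
  using L2_linear[of g M f "-1"] by simp

lemma l2_inner_linear:
  assumes "f \<in> L2 M" "g \<in> L2 M" "h \<in> L2 M"
  shows "l2_inner M (\<lambda>x. c * f x + g x) h = c * l2_inner M f h + l2_inner M g h"
proof -
  have "l2_inner M (\<lambda>x. c * f x + g x) h = (LINT x|M. c * (f x * cnj (h x)) + g x * cnj (h x))"
    unfolding l2_inner_def by (simp add: algebra_simps)
  then show ?thesis
    unfolding l2_inner_def
    using L2_integrable_mult[OF assms(1,3)] L2_integrable_mult[OF assms(2,3)] by simp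
qed

lemma l2_inner_diff:
  assumes "f \<in> L2 M" "g \<in> L2 M" "h \<in> L2 M"
  shows "l2_inner M (\<lambda>x. f x - g x) h = l2_inner M f h - l2_inner M g h"
  using l2_inner_linear[OF assms(2,1,3), of "-1"] by simp

lemma l2_inner_commute: "l2_inner M g f = cnj (l2_inner M f g)"
proof -
  have "cnj (LINT x|M. f x * cnj (g x)) = (LINT x|M. cnj (f x * cnj (g x)))"
    by (rule Bochner_Integration.integral_cnj[symmetric])
  then show ?thesis unfolding l2_inner_def by (simp add: mult.commute)
qed

lemma l2_inner_self: "l2_inner M f f = of_real ((l2_norm M f)\<^sup>2)"
proof -
  have "l2_inner M f f = (LINT x|M. of_real ((cmod (f x))\<^sup>2))"
    unfolding l2_inner_def by (simp add: complex_norm_square[symmetric] del: of_real_power)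
  also have "\<dots> = of_real (LINT x|M. (cmod (f x))\<^sup>2)" by (rule integral_complex_of_real)
  finally show ?thesis by (simp add: l2_norm_def integral_nonneg_AE)
qed

lemma l2_inner_cong:
  assumes "AE x in M. f x = f' x" "AE x in M. g x = g' x"
    and "f \<in> L2 M" "f' \<in> L2 M" "g \<in> L2 M" "g' \<in> L2 M"
  shows "l2_inner M f g = l2_inner M f' g'"
  unfolding l2_inner_def
proof (rule integral_cong_AE)
  show "AE x in M. f x * cnj (g x) = f' x * cnj (g' x)" using assms(1,2) by eventually_elim simp
qed (use assms(3-6)[THEN L2_measurable] in measurable)

lemma l2_norm_nonneg [simp]: "l2_norm M f \<ge> 0"
  by (simp add: l2_norm_def integral_nonneg_AE)

lemma l2_norm_eq_0_AE:
  assumes "f \<in> L2 M" "l2_norm M f = 0"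
  shows "AE x in M. f x = 0"
proof -
  have "(LINT x|M. (cmod (f x))\<^sup>2) = 0"
    using assms(2) by (simp add: l2_norm_def)
  then have "AE x in M. (cmod (f x))\<^sup>2 = 0"
    using assms(1) by (subst (asm) integral_nonneg_eq_0_iff_AE) (auto simp: L2_def)
  then show ?thesis by simp
qed

lemma l2_norm_diff_eq_0_AE:
  assumes "f \<in> L2 M" "g \<in> L2 M" "l2_norm M (\<lambda>x. f x - g x) = 0"
  shows "AE x in M. f x = g x"
  using l2_norm_eq_0_AE[OF L2_diff[OF assms(1,2)] assms(3)] by simp

text \<open>One estimate between nonnegative integrals yields both membership and norm bound, so
  nothing about integrability of \<open>g\<close> has to be known beforehand. Both factors of the
  operators studied below are bounded this way.\<close>

lemma l2_norm_scale_le: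
  assumes f: "f \<in> L2 M" and "g \<in> borel_measurable M" and c: "c \<ge> 0"
    and le: "(\<integral>\<^sup>+x. ennreal ((cmod (g x))\<^sup>2) \<partial>M) \<le> ennreal c * (\<integral>\<^sup>+x. ennreal ((cmod (f x))\<^sup>2) \<partial>M)"
  shows "g \<in> L2 M" "l2_norm M g \<le> sqrt c * l2_norm M f"
proof -
  have le': "(\<integral>\<^sup>+x. ennreal ((cmod (g x))\<^sup>2) \<partial>M) \<le> ennreal (c * (l2_norm M f)\<^sup>2)"
    using le c unfolding L2_nn_integral[OF f] by (simp add: ennreal_mult)
  then have "(\<integral>\<^sup>+x. ennreal ((cmod (g x))\<^sup>2) \<partial>M) < \<infinity>"
    using le_less_trans ennreal_less_top by fastforce
  then show g: "g \<in> L2 M" using assms(2) by (simp add: L2_iff_nn)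
  have "(l2_norm M g)\<^sup>2 \<le> c * (l2_norm M f)\<^sup>2"
    using le' c unfolding L2_nn_integral[OF g] by (simp add: ennreal_le_iff)
  then have "sqrt ((l2_norm M g)\<^sup>2) \<le> sqrt (c * (l2_norm M f)\<^sup>2)" by (rule real_sqrt_le_mono)
  then show "l2_norm M g \<le> sqrt c * l2_norm M f" by (simp add: real_sqrt_mult)
qed

text \<open>The real part of the inner product suffices: whether two operators agree almost
  everywhere is decided by the norm of a difference. The form is only semi-definite, since functions
  that agree almost everywhere stay distinct.\<close>

interpretation L2: semi_inner_space "L2 M" "\<lambda>t f g x. of_real t * f x + g x" "\<lambda>f g. Re (l2_inner M f g)"
  for M :: "'a measure"
proof
  fix f g :: "'a \<Rightarrow> complex" and t
  show "f \<in> L2 M \<Longrightarrow> g \<in> L2 M \<Longrightarrow> (\<lambda>x. complex_of_real t * f x + g x) \<in> L2 M" by (rule L2_linear)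
  show "Re (l2_inner M f g) = Re (l2_inner M g f)" by (subst l2_inner_commute) simp
  show "Re (l2_inner M f f) \<ge> 0" by (simp add: l2_inner_self)
next
  fix f g h :: "'a \<Rightarrow> complex" and t
  assume "f \<in> L2 M" "g \<in> L2 M" "h \<in> L2 M"
  then show "Re (l2_inner M (\<lambda>x. complex_of_real t * f x + g x) h)
      = t * Re (l2_inner M f h) + Re (l2_inner M g h)" by (simp add: l2_inner_linear)
qed

section \<open>Bounded operators modulo null sets\<close>

lemma bounded_op_L2: "bounded_op M T \<Longrightarrow> f \<in> L2 M \<Longrightarrow> T f \<in> L2 M"
  by (simp add: bounded_op_def)

lemma bounded_op_cong:
  "\<lbrakk>bounded_op M T; f \<in> L2 M; g \<in> L2 M; AE x in M. f x = g x\<rbrakk> \<Longrightarrow> AE x in M. T f x = T g x"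
  by (simp add: bounded_op_def)

lemma bounded_op_linear:
  "\<lbrakk>bounded_op M T; f \<in> L2 M; g \<in> L2 M\<rbrakk> \<Longrightarrow> AE x in M. T (\<lambda>y. c * f y + g y) x = c * T f x + T g x"
  by (simp add: bounded_op_def)

lemma bounded_op_norm:
  assumes "bounded_op M T"
  obtains C where "C \<ge> 0" "\<And>f. f \<in> L2 M \<Longrightarrow> l2_norm M (T f) \<le> C * l2_norm M f"
proof -
  obtain C where C: "\<And>f. f \<in> L2 M \<Longrightarrow> l2_norm M (T f) \<le> C * l2_norm M f"
    using assms unfolding bounded_op_def by blast
  have "l2_norm M (T f) \<le> \<bar>C\<bar> * l2_norm M f" if "f \<in> L2 M" for f
    using C[OF that] mult_right_mono[OF abs_ge_self l2_norm_nonneg, of C M f] by linarith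
  then show thesis using that[of "\<bar>C\<bar>"] by simp
qed

lemma bounded_op_inner_linear:
  assumes "bounded_op M T" "f \<in> L2 M" "g \<in> L2 M" "h \<in> L2 M"
  shows "l2_inner M (T (\<lambda>y. c * f y + g y)) h = c * l2_inner M (T f) h + l2_inner M (T g) h"
proof -
  have "l2_inner M (T (\<lambda>y. c * f y + g y)) h = l2_inner M (\<lambda>x. c * T f x + T g x) h"
    using bounded_op_linear[OF assms(1-3), of c] assms
    by (intro l2_inner_cong bounded_op_L2[OF assms(1)] L2_linear) auto
  then show ?thesis using assms by (simp add: l2_inner_linear bounded_op_L2)
qed

lemma bounded_op_comp:
  assumes S: "bounded_op M S" and T: "bounded_op M T"
  shows "bounded_op M (S \<circ> T)"
  unfolding bounded_op_def
proof (intro conjI ballI impI allI)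
  show "(S \<circ> T) f \<in> L2 M" if "f \<in> L2 M" for f using that by (simp add: bounded_op_L2 S T)
  show "AE x in M. (S \<circ> T) f x = (S \<circ> T) g x" if "f \<in> L2 M" "g \<in> L2 M" "AE x in M. f x = g x" for f g
    using that by (simp add: bounded_op_L2 bounded_op_cong S T)
  show "AE x in M. (S \<circ> T) (\<lambda>y. c * f y + g y) x = c * (S \<circ> T) f x + (S \<circ> T) g x"
    if "f \<in> L2 M" "g \<in> L2 M" for f g c
  proof -
    have "AE x in M. S (T (\<lambda>y. c * f y + g y)) x = S (\<lambda>y. c * T f y + T g y) x"
      using that by (intro bounded_op_cong[OF S] bounded_op_linear[OF T] L2_linear bounded_op_L2[OF T])
    moreover have "AE x in M. S (\<lambda>y. c * T f y + T g y) x = c * S (T f) x + S (T g) x"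
      using that by (intro bounded_op_linear[OF S] bounded_op_L2[OF T])
    ultimately show ?thesis by eventually_elim simp
  qed
  obtain C where C: "C \<ge> 0" "\<And>f. f \<in> L2 M \<Longrightarrow> l2_norm M (S f) \<le> C * l2_norm M f"
    by (rule bounded_op_norm[OF S]) blast
  obtain D where D: "\<And>f. f \<in> L2 M \<Longrightarrow> l2_norm M (T f) \<le> D * l2_norm M f"
    by (rule bounded_op_norm[OF T]) blast
  have "l2_norm M ((S \<circ> T) f) \<le> (C * D) * l2_norm M f" if "f \<in> L2 M" for f
    using order_trans[OF C(2)[OF bounded_op_L2[OF T that]] mult_left_mono[OF D[OF that] C(1)]]
    by (simp add: mult.assoc)
  then show "\<exists>C. \<forall>f\<in>L2 M. l2_norm M ((S \<circ> T) f) \<le> C * l2_norm M f" by blast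
qed

text \<open>The squared norms of f - g and f + g add up to the right side. This stands in for the
  triangle inequality when differences of operators are bounded.\<close>

lemma l2_norm_diff_le:
  assumes "f \<in> L2 M" "g \<in> L2 M"
  shows "(l2_norm M (\<lambda>x. f x - g x))\<^sup>2 \<le> 2 * (l2_norm M f)\<^sup>2 + 2 * (l2_norm M g)\<^sup>2"
proof -
  have 1: "(l2_norm M (\<lambda>x. f x - g x))\<^sup>2 = (l2_norm M g)\<^sup>2 - 2 * Re (l2_inner M g f) + (l2_norm M f)\<^sup>2"
    using L2.ip_lc_self[OF assms(2,1), of "-1"] by (simp add: l2_inner_self)
  have "0 \<le> (l2_norm M (\<lambda>x. g x + f x))\<^sup>2" by simp
  also have "\<dots> = (l2_norm M g)\<^sup>2 + 2 * Re (l2_inner M g f) + (l2_norm M f)\<^sup>2"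
    using L2.ip_lc_self[OF assms(2,1), of 1] by (simp add: l2_inner_self)
  finally show ?thesis using 1 by simp
qed

lemma bounded_op_diff:
  assumes S: "bounded_op M S" and T: "bounded_op M T"
  shows "bounded_op M (\<lambda>f x. S f x - T f x)"
  unfolding bounded_op_def
proof (intro conjI ballI impI allI)
  show "(\<lambda>x. S f x - T f x) \<in> L2 M" if "f \<in> L2 M" for f
    using that by (simp add: bounded_op_L2 L2_diff S T)
  show "AE x in M. S f x - T f x = S g x - T g x" if "f \<in> L2 M" "g \<in> L2 M" "AE x in M. f x = g x" for f g
    using bounded_op_cong[OF S that] bounded_op_cong[OF T that] by eventually_elim simp
  show "AE x in M. S (\<lambda>y. c * f y + g y) x - T (\<lambda>y. c * f y + g y) x = c * (S f x - T f x) + (S g x - T g x)"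
    if "f \<in> L2 M" "g \<in> L2 M" for f g c
    using bounded_op_linear[OF S that, of c] bounded_op_linear[OF T that, of c]
    by eventually_elim (simp add: algebra_simps)
  obtain C where C: "\<And>f. f \<in> L2 M \<Longrightarrow> l2_norm M (S f) \<le> C * l2_norm M f"
    by (rule bounded_op_norm[OF S]) blast
  obtain D where D: "\<And>f. f \<in> L2 M \<Longrightarrow> l2_norm M (T f) \<le> D * l2_norm M f"
    by (rule bounded_op_norm[OF T]) blast
  have "l2_norm M (\<lambda>x. S f x - T f x) \<le> sqrt (2 * C\<^sup>2 + 2 * D\<^sup>2) * l2_norm M f" if "f \<in> L2 M" for f
  proof -
    have "(l2_norm M (\<lambda>x. S f x - T f x))\<^sup>2 \<le> 2 * (l2_norm M (S f))\<^sup>2 + 2 * (l2_norm M (T f))\<^sup>2"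
      by (rule l2_norm_diff_le[OF bounded_op_L2[OF S that] bounded_op_L2[OF T that]])
    also have "\<dots> \<le> 2 * (C * l2_norm M f)\<^sup>2 + 2 * (D * l2_norm M f)\<^sup>2"
      using C[OF that] D[OF that] by (intro add_mono mult_left_mono power_mono) auto
    also have "\<dots> = (2 * C\<^sup>2 + 2 * D\<^sup>2) * (l2_norm M f)\<^sup>2" by (simp add: power_mult_distrib algebra_simps)
    finally have "sqrt ((l2_norm M (\<lambda>x. S f x - T f x))\<^sup>2) \<le> sqrt ((2 * C\<^sup>2 + 2 * D\<^sup>2) * (l2_norm M f)\<^sup>2)"
      by (rule real_sqrt_le_mono)
    then show ?thesis unfolding real_sqrt_mult by simp
  qed
  then show "\<exists>C. \<forall>f\<in>L2 M. l2_norm M (\<lambda>x. S f x - T f x) \<le> C * l2_norm M f" by blast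
qed

text \<open>Nothing is known of \<open>adjoint\<close> beyond \<open>is_adjoint\<close>; uniqueness
  allows an explicit adjoint to replace it. The difference of the two values is tested against
  itself.\<close>

lemma is_adjoint_unique:
  assumes S: "is_adjoint M T S" and S': "is_adjoint M T S'" and T: "bounded_op M T"
  shows "op_eq M S S'"
  unfolding op_eq_def
proof
  fix g assume g: "g \<in> L2 M"
  have SL: "S g \<in> L2 M" "S' g \<in> L2 M" using S S' g by (auto simp: is_adjoint_def bounded_op_L2)
  define d where "d = (\<lambda>x. S g x - S' g x)"
  have d: "d \<in> L2 M" unfolding d_def by (intro L2_diff SL)
  have "l2_inner M d (S g) = l2_inner M d (S' g)"
    using S S' g d unfolding is_adjoint_def by metis
  then have "l2_inner M (S g) d = l2_inner M (S' g) d" by (metis l2_inner_commute)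
  then have "l2_inner M d d = 0" using l2_inner_diff[OF SL d] by (simp add: d_def)
  then have "l2_norm M d = 0" by (simp add: l2_inner_self)
  then show "AE x in M. S g x = S' g x" unfolding d_def by (rule l2_norm_diff_eq_0_AE[OF SL])
qed

lemma op_eq_trans:
  assumes "op_eq M R S" "op_eq M S T"
  shows "op_eq M R T"
  unfolding op_eq_def
proof
  fix f assume "f \<in> L2 M"
  then have "AE x in M. R f x = S f x" "AE x in M. S f x = T f x"
    using assms by (auto simp: op_eq_def)
  then show "AE x in M. R f x = T f x" by eventually_elim simp
qed

lemma op_eq_sym: "op_eq M R S \<Longrightarrow> op_eq M S R"
  unfolding op_eq_def by (simp add: eq_commute)

lemma op_eq_comp:
  assumes "op_eq M S S'" "op_eq M T T'" "bounded_op M S'" "bounded_op M T" "bounded_op M T'"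
  shows "op_eq M (S \<circ> T) (S' \<circ> T')"
  unfolding op_eq_def
proof
  fix f assume f: "f \<in> L2 M"
  have "AE x in M. S (T f) x = S' (T f) x"
    using assms(1) f bounded_op_L2[OF assms(4)] by (simp add: op_eq_def)
  moreover have "AE x in M. S' (T f) x = S' (T' f) x"
    using assms(2) f by (intro bounded_op_cong[OF assms(3)] bounded_op_L2[OF assms(4)] bounded_op_L2[OF assms(5)])
      (auto simp: op_eq_def)
  ultimately show "AE x in M. (S \<circ> T) f x = (S' \<circ> T') f x" by eventually_elim simp
qed

text \<open>Over the complex scalars positivity implies symmetry: expand (P h, h) at h = f + ig.\<close>

lemma positive_op_pos_bdd:
  assumes P: "positive_op M P"
  shows "L2.pos_bdd M P"
  unfolding L2.pos_bdd_def
proof (intro conjI ballI allI)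
  have b: "bounded_op M P" using P by (simp add: positive_op_def)
  show "P f \<in> L2 M" if "f \<in> L2 M" for f using b that by (rule bounded_op_L2)
  show "Re (l2_inner M (P (\<lambda>x. complex_of_real t * f x + g x)) h)
      = t * Re (l2_inner M (P f) h) + Re (l2_inner M (P g) h)"
    if "f \<in> L2 M" "g \<in> L2 M" "h \<in> L2 M" for f g h t
    using bounded_op_inner_linear[OF b that] by simp
  show "Re (l2_inner M (P f) f) \<ge> 0" if "f \<in> L2 M" for f using P that by (simp add: positive_op_def)
  show "Re (l2_inner M (P f) g) = Re (l2_inner M f (P g))" if f: "f \<in> L2 M" and g: "g \<in> L2 M" for f g
  proof -
    define h where "h = (\<lambda>x. \<i> * g x + f x)"
    have h: "h \<in> L2 M" unfolding h_def by (intro L2_linear f g)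
    have PL: "P f \<in> L2 M" "P g \<in> L2 M" by (auto intro: bounded_op_L2[OF b] f g)
    have A: "l2_inner M k h = - \<i> * l2_inner M k g + l2_inner M k f" if "k \<in> L2 M" for k
    proof -
      have "l2_inner M k h = cnj (\<i> * l2_inner M g k + l2_inner M f k)"
        by (subst l2_inner_commute) (simp only: h_def l2_inner_linear[OF g f that])
      then show ?thesis by (simp add: l2_inner_commute[of M k])
    qed
    have "l2_inner M (P h) h = \<i> * l2_inner M (P g) h + l2_inner M (P f) h"
      using bounded_op_inner_linear[OF b g f h, of \<i>] by (simp add: h_def)
    \<comment> \<open>Positivity makes the left side and the last two terms vanish, so the two mixed
      real parts coincide.\<close>
    also have "Im \<dots> = Re (l2_inner M (P g) f) - Re (l2_inner M (P f) g)
        + Im (l2_inner M (P g) g) + Im (l2_inner M (P f) f)"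
      by (simp add: A[OF PL(1)] A[OF PL(2)])
    finally have "Re (l2_inner M (P g) f) = Re (l2_inner M (P f) g)"
      using P f g h by (simp add: positive_op_def)
    moreover have "Re (l2_inner M (P g) f) = Re (l2_inner M f (P g))"
      by (subst l2_inner_commute) simp
    ultimately show ?thesis by simp
  qed
  obtain C where C: "\<And>f. f \<in> L2 M \<Longrightarrow> l2_norm M (P f) \<le> C * l2_norm M f"
    by (rule bounded_op_norm[OF b]) blast
  have "(l2_norm M (P f))\<^sup>2 \<le> C\<^sup>2 * (l2_norm M f)\<^sup>2" if "f \<in> L2 M" for f
    using power_mono[OF C[OF that], of 2] by (simp add: power_mult_distrib)
  then show "\<exists>C. \<forall>f\<in>L2 M. Re (l2_inner M (P f) (P f)) \<le> C * Re (l2_inner M f f)"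
    unfolding l2_inner_self by auto
qed

lemma positive_sqrt_unique:
  assumes A: "positive_op M A" and R: "positive_op M R" and eq: "op_eq M (A \<circ> A) (R \<circ> R)"
  shows "op_eq M A R"
  unfolding op_eq_def
proof
  fix f assume f: "f \<in> L2 M"
  have bA: "bounded_op M A" and bR: "bounded_op M R" using A R by (auto simp: positive_op_def)
  have AARR: "Re (l2_inner M (A (A f)) g) = Re (l2_inner M (R (R f)) g)" if "f \<in> L2 M" "g \<in> L2 M" for f g
  proof -
    have "AE x in M. A (A f) x = R (R f) x" using eq that by (simp add: op_eq_def)
    then have "l2_inner M (A (A f)) g = l2_inner M (R (R f)) g"
      using that by (intro l2_inner_cong[OF _ AE_I2[OF refl]]) (simp_all add: bounded_op_L2[OF bA] bounded_op_L2[OF bR])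
    then show ?thesis by simp
  qed
  have "Re (l2_inner M (\<lambda>x. of_real (-1) * R f x + A f x) (\<lambda>x. of_real (-1) * R f x + A f x)) = 0"
    by (rule L2.pos_sqrt_unique[OF positive_op_pos_bdd[OF A] positive_op_pos_bdd[OF R] AARR f])
  also have "(\<lambda>x. of_real (-1) * R f x + A f x) = (\<lambda>x. A f x - R f x)" by simp
  finally have "l2_norm M (\<lambda>x. A f x - R f x) = 0" unfolding l2_inner_self by simp
  then show "AE x in M. A f x = R f x"
    by (rule l2_norm_diff_eq_0_AE[OF bounded_op_L2[OF bA f] bounded_op_L2[OF bR f]])
qed

text \<open>\<open>op_abs\<close> rests on two nested \<open>SOME\<close> choices. The explicit
  \<open>S\<close> and \<open>R\<close> are witnesses that both choices succeed, and the two
  uniqueness results then force the outcome to be \<open>R\<close> almost everywhere.\<close>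

lemma op_abs_eqI:
  assumes T: "bounded_op M T" and S: "is_adjoint M T S"
    and R: "positive_op M R" and eq: "op_eq M (R \<circ> R) (S \<circ> T)"
  shows "positive_op M (op_abs M T)" "op_eq M (op_abs M T) R"
proof -
  have adj: "is_adjoint M T (adjoint M T)"
    unfolding adjoint_def by (rule someI[where P = "is_adjoint M T" and x = S]) (rule S)
  have "op_eq M (S \<circ> T) (adjoint M T \<circ> T)"
    using is_adjoint_unique[OF S adj T] bounded_op_L2[OF T] by (simp add: op_eq_def)
  then have R': "op_eq M (R \<circ> R) (adjoint M T \<circ> T)" by (rule op_eq_trans[OF eq])
  with R have "positive_op M R \<and> op_eq M (R \<circ> R) (adjoint M T \<circ> T)" ..
  then have *: "positive_op M (op_abs M T) \<and> op_eq M (op_abs M T \<circ> op_abs M T) (adjoint M T \<circ> T)"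
    unfolding op_abs_def op_sqrt_def
    by (rule someI[where P = "\<lambda>R. positive_op M R \<and> op_eq M (R \<circ> R) (adjoint M T \<circ> T)"])
  then show "positive_op M (op_abs M T)" by simp
  have "op_eq M (op_abs M T \<circ> op_abs M T) (R \<circ> R)"
    using op_eq_trans[OF conjunct2[OF *] op_eq_sym[OF R']] .
  then show "op_eq M (op_abs M T) R" by (rule positive_sqrt_unique[OF conjunct1[OF *] R])
qed

section \<open>Complex conditional expectation\<close>

context sigma_finite_subalgebra
begin

lemma F_measurable_M: "f \<in> borel_measurable F \<Longrightarrow> f \<in> borel_measurable M"
  by (rule measurable_from_subalg[OF subalg])

lemma nn_cond_exp_one_intg:
  "f \<in> borel_measurable M \<Longrightarrow> (\<integral>\<^sup>+x. nn_cond_exp M F f x \<partial>M) = (\<integral>\<^sup>+x. f x \<partial>M)"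
  using nn_cond_exp_intg[of "\<lambda>_. 1" f] by simp

section \<open>Real conditional expectation beyond integrable functions\<close>

lemma real_cond_exp_uminus: "real_cond_exp M F (\<lambda>x. - f x) x = - real_cond_exp M F f x"
  by (simp add: real_cond_exp_def)

lemma real_cond_exp_mult_nonneg:
  assumes [measurable]: "f \<in> borel_measurable F" "g \<in> borel_measurable M" and f: "\<And>x. f x \<ge> 0"
  shows "AE x in M. real_cond_exp M F (\<lambda>x. f x * g x) x = f x * real_cond_exp M F g x"
proof -
  have [measurable]: "f \<in> borel_measurable M" by (rule F_measurable_M) fact
  have 1: "AE x in M. ennreal (f x) * nn_cond_exp M F (\<lambda>x. ennreal (g x)) x
      = nn_cond_exp M F (\<lambda>x. ennreal (f x) * ennreal (g x)) x"
    by (rule nn_cond_exp_prod) measurable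
  have 2: "AE x in M. ennreal (f x) * nn_cond_exp M F (\<lambda>x. ennreal (- g x)) x
      = nn_cond_exp M F (\<lambda>x. ennreal (f x) * ennreal (- g x)) x"
    by (rule nn_cond_exp_prod) measurable
  have e: "ennreal (f x) * ennreal (g x) = ennreal (f x * g x)"
    "ennreal (f x) * ennreal (- g x) = ennreal (- (f x * g x))" for x
    using ennreal_mult'[OF f, of x "g x"] ennreal_mult'[OF f, of x "- g x"] by simp_all
  show ?thesis using 1 2 unfolding e real_cond_exp_def
  proof eventually_elim
    case (elim x)
    then show ?case
      by (simp add: elim[symmetric] enn2real_mult f right_diff_distrib)
  qed
qed

text \<open>No integrability is needed: \<^const>\<open>enn2real\<close> maps an infinite conditional expectation to 0,
  and this junk value is compatible with the multiplication.\<close>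

lemma real_cond_exp_mult_any:
  assumes [measurable]: "f \<in> borel_measurable F" "g \<in> borel_measurable M"
  shows "AE x in M. real_cond_exp M F (\<lambda>x. f x * g x) x = f x * real_cond_exp M F g x"
proof -
  have [measurable]: "f \<in> borel_measurable M" by (rule F_measurable_M) fact
  \<comment> \<open>The sign of \<open>f\<close> is \<open>F\<close>-measurable, so both sides can
    be compared separately where \<open>f\<close> is nonnegative and where it is negative; in the
    second case the nonnegative factor is \<open>- (n x * f x)\<close> and the sign is taken out at
    the end.\<close>
  define p n where "p x = indicat_real {x. f x \<ge> 0} x" and "n x = indicat_real {x. f x < 0} x" for x
  have [measurable]: "p \<in> borel_measurable F" "n \<in> borel_measurable F"
    unfolding p_def n_def indicator_def by measurable
  have "AE x in M. real_cond_exp M F (\<lambda>x. p x * (f x * g x)) x = p x * real_cond_exp M F (\<lambda>x. f x * g x) x"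
    by (rule real_cond_exp_mult_nonneg) (auto simp: p_def)
  moreover have "AE x in M. real_cond_exp M F (\<lambda>x. (p x * f x) * g x) x = (p x * f x) * real_cond_exp M F g x"
    by (rule real_cond_exp_mult_nonneg) (auto simp: p_def indicator_def)
  moreover have "AE x in M. real_cond_exp M F (\<lambda>x. n x * (f x * g x)) x = n x * real_cond_exp M F (\<lambda>x. f x * g x) x"
    by (rule real_cond_exp_mult_nonneg) (auto simp: n_def)
  moreover have "AE x in M. real_cond_exp M F (\<lambda>x. (- (n x * f x)) * g x) x = (- (n x * f x)) * real_cond_exp M F g x"
    by (rule real_cond_exp_mult_nonneg) (auto simp: n_def indicator_def)
  ultimately show ?thesis
  proof eventually_elim
    case (elim x)
    have "real_cond_exp M F (\<lambda>x. n x * (f x * g x)) x = n x * f x * real_cond_exp M F g x"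
      using elim(4) by (simp add: real_cond_exp_uminus mult.assoc)
    then show ?case using elim by (cases "f x \<ge> 0") (auto simp: p_def n_def mult.assoc)
  qed
qed

text \<open>Membership in D(E) offers only that E|f| and E|g| are finite almost everywhere, not that
  f and g are integrable. Unlike for products, finiteness matters here: the default value 0 of
  \<open>enn2real\<close> at infinity does not respect sums.\<close>

lemma real_cond_exp_add_finite:
  assumes [measurable]: "f \<in> borel_measurable M" "g \<in> borel_measurable M"
    and f: "AE x in M. nn_cond_exp M F (\<lambda>y. ennreal \<bar>f y\<bar>) x \<noteq> \<infinity>"
    and g: "AE x in M. nn_cond_exp M F (\<lambda>y. ennreal \<bar>g y\<bar>) x \<noteq> \<infinity>"
  shows "AE x in M. real_cond_exp M F (\<lambda>x. f x + g x) x = real_cond_exp M F f x + real_cond_exp M F g x"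
proof -
  let ?E = "nn_cond_exp M F"
  \<comment> \<open>Positive and negative parts are moved to opposite sides, so that E is applied to
    sums of nonnegative functions only and subtraction is postponed until all six terms are known to
    be finite.\<close>
  have split: "ennreal (f x + g x) + (ennreal (- f x) + ennreal (- g x))
      = ennreal (- (f x + g x)) + (ennreal (f x) + ennreal (g x))" for x
    by (cases "f x \<ge> 0"; cases "g x \<ge> 0"; cases "f x + g x \<ge> 0")
      (simp_all add: ennreal_neg ennreal_plus[symmetric] add_nonneg_nonneg del: ennreal_plus)
  have sums: "AE x in M. ?E (\<lambda>x. ennreal (f x + g x)) x + ?E (\<lambda>x. ennreal (- f x) + ennreal (- g x)) x
      = ?E (\<lambda>x. ennreal (f x + g x) + (ennreal (- f x) + ennreal (- g x))) x"
    "AE x in M. ?E (\<lambda>x. ennreal (- f x)) x + ?E (\<lambda>x. ennreal (- g x)) x = ?E (\<lambda>x. ennreal (- f x) + ennreal (- g x)) x"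
    "AE x in M. ?E (\<lambda>x. ennreal (- (f x + g x))) x + ?E (\<lambda>x. ennreal (f x) + ennreal (g x)) x
      = ?E (\<lambda>x. ennreal (- (f x + g x)) + (ennreal (f x) + ennreal (g x))) x"
    "AE x in M. ?E (\<lambda>x. ennreal (f x)) x + ?E (\<lambda>x. ennreal (g x)) x = ?E (\<lambda>x. ennreal (f x) + ennreal (g x)) x"
    "AE x in M. ?E (\<lambda>x. ennreal \<bar>f x\<bar>) x + ?E (\<lambda>x. ennreal \<bar>g x\<bar>) x = ?E (\<lambda>x. ennreal \<bar>f x\<bar> + ennreal \<bar>g x\<bar>) x"
    by (rule nn_cond_exp_sum; measurable)+
  have abs: "ennreal \<bar>f x\<bar> + ennreal \<bar>g x\<bar> = ennreal (\<bar>f x\<bar> + \<bar>g x\<bar>)" for x by simp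
  have le: "AE x in M. ?E (\<lambda>x. ennreal (f x + g x)) x \<le> ?E (\<lambda>x. ennreal \<bar>f x\<bar> + ennreal \<bar>g x\<bar>) x"
    "AE x in M. ?E (\<lambda>x. ennreal (- (f x + g x))) x \<le> ?E (\<lambda>x. ennreal \<bar>f x\<bar> + ennreal \<bar>g x\<bar>) x"
    "AE x in M. ?E (\<lambda>x. ennreal (f x)) x \<le> ?E (\<lambda>x. ennreal \<bar>f x\<bar>) x"
    "AE x in M. ?E (\<lambda>x. ennreal (- f x)) x \<le> ?E (\<lambda>x. ennreal \<bar>f x\<bar>) x"
    "AE x in M. ?E (\<lambda>x. ennreal (g x)) x \<le> ?E (\<lambda>x. ennreal \<bar>g x\<bar>) x"
    "AE x in M. ?E (\<lambda>x. ennreal (- g x)) x \<le> ?E (\<lambda>x. ennreal \<bar>g x\<bar>) x"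
    unfolding abs by (rule nn_cond_exp_mono[OF AE_I2]; ((rule ennreal_leI, arith) | measurable))+
  show ?thesis using sums le f g
  proof eventually_elim
    case (elim x)
    have fin: "?E (\<lambda>x. ennreal (f x + g x)) x < \<infinity>" "?E (\<lambda>x. ennreal (- (f x + g x))) x < \<infinity>"
      "?E (\<lambda>x. ennreal (f x)) x < \<infinity>" "?E (\<lambda>x. ennreal (- f x)) x < \<infinity>"
      "?E (\<lambda>x. ennreal (g x)) x < \<infinity>" "?E (\<lambda>x. ennreal (- g x)) x < \<infinity>"
      using elim by (auto simp: less_top[symmetric] top_unique elim(5)[symmetric])
    have "?E (\<lambda>x. ennreal (f x + g x)) x + (?E (\<lambda>x. ennreal (- f x)) x + ?E (\<lambda>x. ennreal (- g x)) x)
        = ?E (\<lambda>x. ennreal (- (f x + g x))) x + (?E (\<lambda>x. ennreal (f x)) x + ?E (\<lambda>x. ennreal (g x)) x)"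
      using elim(1-4) unfolding split by simp
    from arg_cong[OF this, of enn2real] fin show ?case
      unfolding real_cond_exp_def by (simp add: enn2real_plus)
  qed
qed

section \<open>Passage to complex values\<close>

lemma cexp_Re_Im: "cexp M F f = (\<lambda>x. of_real (real_cond_exp M F (\<lambda>y. Re (f y)) x)
    + \<i> * of_real (real_cond_exp M F (\<lambda>y. Im (f y)) x))"
  by (simp add: cexp_def complex_eq_iff fun_eq_iff)

lemma cexp_F_measurable [measurable]: "cexp M F f \<in> borel_measurable F"
  unfolding cexp_Re_Im by measurable

lemma cexp_M_measurable [measurable]: "cexp M F f \<in> borel_measurable M"
  by (rule F_measurable_M) (rule cexp_F_measurable)

lemma cexp_cong:
  assumes "AE x in M. f x = g x" and [measurable]: "f \<in> borel_measurable M" "g \<in> borel_measurable M"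
  shows "AE x in M. cexp M F f x = cexp M F g x"
proof -
  have ae: "AE x in M. Re (f x) = Re (g x)" "AE x in M. Im (f x) = Im (g x)"
    using assms(1) by (eventually_elim, simp)+
  have "AE x in M. real_cond_exp M F (\<lambda>y. Re (f y)) x = real_cond_exp M F (\<lambda>y. Re (g y)) x"
    "AE x in M. real_cond_exp M F (\<lambda>y. Im (f y)) x = real_cond_exp M F (\<lambda>y. Im (g y)) x"
    by (rule real_cond_exp_cong[OF ae(1)] real_cond_exp_cong[OF ae(2)]; measurable)+
  then show ?thesis unfolding cexp_def by eventually_elim simp
qed

lemma domE_measurable: "f \<in> domE M F \<Longrightarrow> f \<in> borel_measurable M"
  by (simp add: domE_def)

lemma domE_bound:
  assumes "g \<in> domE M F" "AE x in M. cmod (f x) \<le> cmod (g x)" and [measurable]: "f \<in> borel_measurable M"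
  shows "f \<in> domE M F"
proof -
  have [measurable]: "g \<in> borel_measurable M" by (rule domE_measurable[OF assms(1)])
  have "AE x in M. nn_cond_exp M F (\<lambda>y. ennreal (cmod (f y))) x \<le> nn_cond_exp M F (\<lambda>y. ennreal (cmod (g y))) x"
    by (rule nn_cond_exp_mono) (use assms(2) in \<open>auto elim!: eventually_mono intro: ennreal_leI\<close>)
  moreover have "AE x in M. nn_cond_exp M F (\<lambda>y. ennreal (cmod (g y))) x \<noteq> \<infinity>"
    using assms(1) by (simp add: domE_def)
  ultimately have "AE x in M. nn_cond_exp M F (\<lambda>y. ennreal (cmod (f y))) x \<noteq> \<infinity>"
    by eventually_elim (auto simp: top_unique)
  then show ?thesis by (simp add: domE_def)
qed

text \<open>No bound on \<open>f\<close> is required: E(|f g|) = |f| E(|g|), and |f| is finite at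
  every point.\<close>

lemma domE_mult:
  assumes [measurable]: "f \<in> borel_measurable F" and g: "g \<in> domE M F"
  shows "(\<lambda>x. f x * g x) \<in> domE M F"
proof -
  have [measurable]: "f \<in> borel_measurable M" "g \<in> borel_measurable M"
    using g by (auto intro: F_measurable_M domE_measurable)
  have "AE x in M. ennreal (cmod (f x)) * nn_cond_exp M F (\<lambda>y. ennreal (cmod (g y))) x
      = nn_cond_exp M F (\<lambda>y. ennreal (cmod (f y)) * ennreal (cmod (g y))) x"
    by (rule nn_cond_exp_prod) measurable
  moreover have "AE x in M. nn_cond_exp M F (\<lambda>y. ennreal (cmod (g y))) x \<noteq> \<infinity>"
    using g by (simp add: domE_def)
  ultimately have "AE x in M. nn_cond_exp M F (\<lambda>y. ennreal (cmod (f y)) * ennreal (cmod (g y))) x \<noteq> \<infinity>"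
    by eventually_elim (metis ennreal_mult_eq_top_iff ennreal_neq_top infinity_ennreal_def)
  then show ?thesis by (simp add: domE_def norm_mult ennreal_mult)
qed

lemma domE_Re_Im:
  assumes "f \<in> domE M F"
  shows "AE x in M. nn_cond_exp M F (\<lambda>y. ennreal \<bar>Re (f y)\<bar>) x \<noteq> \<infinity>"
    "AE x in M. nn_cond_exp M F (\<lambda>y. ennreal \<bar>Im (f y)\<bar>) x \<noteq> \<infinity>"
proof -
  have [measurable]: "f \<in> borel_measurable M" by (rule domE_measurable[OF assms])
  have "(\<lambda>x. of_real (Re (f x))) \<in> domE M F" "(\<lambda>x. of_real (Im (f x))) \<in> domE M F"
    by (rule domE_bound[OF assms]; simp add: abs_Re_le_cmod abs_Im_le_cmod)+
  then show "AE x in M. nn_cond_exp M F (\<lambda>y. ennreal \<bar>Re (f y)\<bar>) x \<noteq> \<infinity>"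
    "AE x in M. nn_cond_exp M F (\<lambda>y. ennreal \<bar>Im (f y)\<bar>) x \<noteq> \<infinity>"
    by (simp_all add: domE_def)
qed

lemma cexp_add:
  assumes f: "f \<in> domE M F" and g: "g \<in> domE M F"
  shows "AE x in M. cexp M F (\<lambda>x. f x + g x) x = cexp M F f x + cexp M F g x"
proof -
  have [measurable]: "f \<in> borel_measurable M" "g \<in> borel_measurable M"
    using assms by (auto intro: domE_measurable)
  have "AE x in M. real_cond_exp M F (\<lambda>y. Re (f y) + Re (g y)) x
      = real_cond_exp M F (\<lambda>y. Re (f y)) x + real_cond_exp M F (\<lambda>y. Re (g y)) x"
    "AE x in M. real_cond_exp M F (\<lambda>y. Im (f y) + Im (g y)) x
      = real_cond_exp M F (\<lambda>y. Im (f y)) x + real_cond_exp M F (\<lambda>y. Im (g y)) x"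
    by (rule real_cond_exp_add_finite; (rule domE_Re_Im[OF f] domE_Re_Im[OF g] | measurable))+
  then show ?thesis unfolding cexp_def by eventually_elim (simp add: complex_eq_iff)
qed

text \<open>A real factor acts on real and imaginary part separately, so no sum is formed and
  \<open>g\<close> need not lie in \<open>domE M F\<close>. This matters for products u f with f in
  L^2, whose conditional expectation may be infinite where E(|u|^2) is.\<close>

lemma cexp_mult_real:
  assumes [measurable]: "f \<in> borel_measurable F" "g \<in> borel_measurable M"
  shows "AE x in M. cexp M F (\<lambda>x. of_real (f x) * g x) x = of_real (f x) * cexp M F g x"
proof -
  have "AE x in M. real_cond_exp M F (\<lambda>y. f y * Re (g y)) x = f x * real_cond_exp M F (\<lambda>y. Re (g y)) x"
    "AE x in M. real_cond_exp M F (\<lambda>y. f y * Im (g y)) x = f x * real_cond_exp M F (\<lambda>y. Im (g y)) x"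
    by (rule real_cond_exp_mult_any; measurable)+
  then show ?thesis unfolding cexp_def by eventually_elim (simp add: complex_eq_iff)
qed

lemma cexp_mult_ii: "cexp M F (\<lambda>x. \<i> * f x) x = \<i> * cexp M F f x"
  by (simp add: cexp_def complex_eq_iff real_cond_exp_uminus)

lemma cexp_mult:
  assumes [measurable]: "f \<in> borel_measurable F" and g: "g \<in> domE M F"
  shows "AE x in M. cexp M F (\<lambda>x. f x * g x) x = f x * cexp M F g x"
proof -
  have [measurable]: "f \<in> borel_measurable M" "g \<in> borel_measurable M"
    using g by (auto intro: F_measurable_M domE_measurable)
  have e: "of_real (Re (f x)) * g x + of_real (Im (f x)) * (\<i> * g x) = f x * g x" for x
    by (simp add: complex_eq_iff)
  have ig: "(\<lambda>x. \<i> * g x) \<in> domE M F" by (rule domE_mult) (auto simp: g)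
  have "AE x in M. cexp M F (\<lambda>x. of_real (Re (f x)) * g x + of_real (Im (f x)) * (\<i> * g x)) x
      = cexp M F (\<lambda>x. of_real (Re (f x)) * g x) x + cexp M F (\<lambda>x. of_real (Im (f x)) * (\<i> * g x)) x"
    by (intro cexp_add domE_mult g ig) measurable
  moreover have "AE x in M. cexp M F (\<lambda>x. of_real (Re (f x)) * g x) x = of_real (Re (f x)) * cexp M F g x"
    by (rule cexp_mult_real) measurable
  moreover have "AE x in M. cexp M F (\<lambda>x. of_real (Im (f x)) * (\<i> * g x)) x
      = of_real (Im (f x)) * cexp M F (\<lambda>x. \<i> * g x) x"
    by (rule cexp_mult_real) measurable
  ultimately show ?thesis
    unfolding e by eventually_elim (simp add: cexp_mult_ii complex_eq_iff)
qed

lemma cexp_integral: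
  assumes "integrable M f"
  shows "(LINT x|M. cexp M F f x) = (LINT x|M. f x)"
proof -
  have 1: "integrable M (\<lambda>y. Re (f y))" "integrable M (\<lambda>y. Im (f y))" using assms by auto
  have 2: "integrable M (cexp M F f)"
    unfolding cexp_Re_Im
    using real_cond_exp_int(1)[OF 1(1)] real_cond_exp_int(1)[OF 1(2)] by simp
  show ?thesis
    using assms 2 real_cond_exp_int(2)[OF 1(1)] real_cond_exp_int(2)[OF 1(2)]
    by (simp add: complex_eq_iff integral_Re[symmetric] integral_Im[symmetric] cexp_def del: integral_Re integral_Im)
qed

text \<open>With p = E f, the factor cnj p is \<open>F\<close>-measurable and turns E f into |p|^2,
  which is real; the estimate |E g| \<le> E|g| for real functions applies to Re (cnj p f), and one
  factor |p| cancels where it is nonzero.\<close>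

lemma cmod_cexp_le:
  assumes f: "f \<in> domE M F"
  shows "AE x in M. ennreal (cmod (cexp M F f x)) \<le> nn_cond_exp M F (\<lambda>y. ennreal (cmod (f y))) x"
proof -
  have [measurable]: "f \<in> borel_measurable M" by (rule domE_measurable[OF f])
  define p where "p = cexp M F f"
  have [measurable]: "p \<in> borel_measurable F" "p \<in> borel_measurable M" by (auto simp: p_def)
  have "AE x in M. cexp M F (\<lambda>x. cnj (p x) * f x) x = cnj (p x) * p x"
    using cexp_mult[of "\<lambda>x. cnj (p x)" f] f by (simp add: p_def)
  moreover have "AE x in M. ennreal \<bar>real_cond_exp M F (\<lambda>x. Re (cnj (p x) * f x)) x\<bar>
      \<le> nn_cond_exp M F (\<lambda>x. ennreal \<bar>Re (cnj (p x) * f x)\<bar>) x"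
    by (rule real_cond_exp_abs) measurable
  moreover have "AE x in M. nn_cond_exp M F (\<lambda>x. ennreal \<bar>Re (cnj (p x) * f x)\<bar>) x
      \<le> nn_cond_exp M F (\<lambda>x. ennreal (cmod (p x)) * ennreal (cmod (f x))) x"
  proof (rule nn_cond_exp_mono)
    have "\<bar>Re (cnj (p x) * f x)\<bar> \<le> cmod (p x) * cmod (f x)" for x
      by (rule order_trans[OF abs_Re_le_cmod]) (simp add: norm_mult)
    then show "AE x in M. ennreal \<bar>Re (cnj (p x) * f x)\<bar> \<le> ennreal (cmod (p x)) * ennreal (cmod (f x))"
      by (simp add: ennreal_mult[symmetric] ennreal_leI)
  qed measurable
  moreover have "AE x in M. ennreal (cmod (p x)) * nn_cond_exp M F (\<lambda>x. ennreal (cmod (f x))) x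
      = nn_cond_exp M F (\<lambda>x. ennreal (cmod (p x)) * ennreal (cmod (f x))) x"
    by (rule nn_cond_exp_prod) measurable
  ultimately show ?thesis
    unfolding p_def[symmetric]
  proof eventually_elim
    case (elim x)
    have "real_cond_exp M F (\<lambda>x. Re (cnj (p x) * f x)) x = Re (cnj (p x) * p x)"
      using elim(1) by (simp add: cexp_def complex_eq_iff)
    also have "\<dots> = cmod (p x) * cmod (p x)"
      by (simp add: cmod_power2[symmetric] power2_eq_square[symmetric])
    finally have "ennreal (cmod (p x)) * ennreal (cmod (p x))
        \<le> ennreal (cmod (p x)) * nn_cond_exp M F (\<lambda>x. ennreal (cmod (f x))) x"
      using elim(2-4) by (simp add: ennreal_mult[symmetric])
    then show ?case
      by (cases "cmod (p x) = 0") (auto simp: ennreal_mult_le_mult_iff)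
  qed
qed

end

section \<open>Weighted conditional expectations\<close>

text \<open>The conditional counterpart of the rank-one operator f -> (f, p) q: the scalar (f, p)
  becomes the \<open>F\<close>-measurable function E(f cnj p).\<close>

definition rank_op :: "'a measure \<Rightarrow> 'a measure \<Rightarrow> ('a \<Rightarrow> complex) \<Rightarrow> ('a \<Rightarrow> complex) \<Rightarrow> 'a op" where
  "rank_op M F q p = (\<lambda>f x. q x * cexp M F (\<lambda>y. f y * cnj (p y)) x)"

text \<open>The function \<open>p\<close> itself may be unbounded: a bound on E(|p|^2) is enough for
  h -> p h to be bounded on \<open>F\<close>-measurable square-integrable functions, and for f ->
  E(f cnj p) to be bounded on L^2.\<close>

definition Esq_bdd :: "'a measure \<Rightarrow> 'a measure \<Rightarrow> ('a \<Rightarrow> complex) \<Rightarrow> bool" where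
  "Esq_bdd M F p \<longleftrightarrow> p \<in> borel_measurable M \<and> (\<exists>c\<ge>0. AE x in M. Esq M F p x \<le> ennreal c)"

context sigma_finite_subalgebra
begin

lemma Esq_F_measurable [measurable]: "Esq M F p \<in> borel_measurable F"
  by (simp add: Esq_def)

lemma Esq_M_measurable [measurable]: "Esq M F p \<in> borel_measurable M"
  by (simp add: Esq_def)

text \<open>The inequality |f g| \<le> t/2 |f|^2 + 1/(2t) |g|^2 holds for any positive weight t. An
  \<open>F\<close>-measurable t passes through E and may therefore be optimised at each
  point.\<close>

lemma nn_cond_exp_Cauchy_Schwarz:
  assumes [measurable]: "f \<in> borel_measurable M" "g \<in> borel_measurable M"
    and f: "AE x in M. Esq M F f x \<noteq> \<infinity>" and g: "AE x in M. Esq M F g x \<noteq> \<infinity>"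
  shows "AE x in M. nn_cond_exp M F (\<lambda>y. ennreal (cmod (f y) * cmod (g y))) x
    \<le> ennreal (sqrt (enn2real (Esq M F f x) * enn2real (Esq M F g x)))"
proof -
  let ?E = "nn_cond_exp M F"
  define A B where "A x = enn2real (Esq M F f x)" and "B x = enn2real (Esq M F g x)" for x
  have [measurable]: "A \<in> borel_measurable F" "B \<in> borel_measurable F"
    unfolding A_def B_def by measurable
  have step: "AE x in M. ?E (\<lambda>y. ennreal (cmod (f y) * cmod (g y))) x \<le> ennreal (sqrt ((A x + e) * (B x + e)))"
    if e: "e > 0" for e :: real
  proof -
    \<comment> \<open>The optimal weight would be sqrt (B/A); the shift by \<open>e\<close> keeps it
      positive and finite where \<open>A\<close> or \<open>B\<close> vanishes.\<close>
    define t where "t x = sqrt ((B x + e) / (A x + e))" for x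
    have AB: "A x \<ge> 0" "B x \<ge> 0" for x by (simp_all add: A_def B_def)
    have t: "t x > 0" for x
      unfolding t_def using AB[of x] e by (auto intro!: divide_pos_pos add_nonneg_pos)
    have [measurable]: "t \<in> borel_measurable F" unfolding t_def by measurable
    have [measurable]: "t \<in> borel_measurable M" by (rule F_measurable_M) fact
    have "AE x in M. ?E (\<lambda>y. ennreal (cmod (f y) * cmod (g y))) x
      \<le> ?E (\<lambda>y. ennreal (t y / 2) * ennreal ((cmod (f y))\<^sup>2) + ennreal (1 / (2 * t y)) * ennreal ((cmod (g y))\<^sup>2)) x"
    proof (rule nn_cond_exp_mono)
      have "ennreal (cmod (f x) * cmod (g x)) \<le> ennreal (t x / 2) * ennreal ((cmod (f x))\<^sup>2)
        + ennreal (1 / (2 * t x)) * ennreal ((cmod (g x))\<^sup>2)" for x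
      proof -
        have "0 \<le> (t x * cmod (f x) - cmod (g x))\<^sup>2 / (2 * t x)" using t[of x] by simp
        also have "\<dots> = t x / 2 * (cmod (f x))\<^sup>2 + 1 / (2 * t x) * (cmod (g x))\<^sup>2 - cmod (f x) * cmod (g x)"
          using t[of x] by (simp add: field_simps power2_eq_square)
        finally have "cmod (f x) * cmod (g x) \<le> t x / 2 * (cmod (f x))\<^sup>2 + 1 / (2 * t x) * (cmod (g x))\<^sup>2" by simp
        then show ?thesis
          using t[of x] by (subst (1 2) ennreal_mult[symmetric]) (auto simp: ennreal_plus[symmetric] ennreal_leI simp del: ennreal_plus)
      qed
      then show "AE x in M. ennreal (cmod (f x) * cmod (g x)) \<le> ennreal (t x / 2) * ennreal ((cmod (f x))\<^sup>2)
        + ennreal (1 / (2 * t x)) * ennreal ((cmod (g x))\<^sup>2)" by simp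
    qed measurable
    moreover have "AE x in M. ?E (\<lambda>y. ennreal (t y / 2) * ennreal ((cmod (f y))\<^sup>2)) x
        + ?E (\<lambda>y. ennreal (1 / (2 * t y)) * ennreal ((cmod (g y))\<^sup>2)) x
      = ?E (\<lambda>y. ennreal (t y / 2) * ennreal ((cmod (f y))\<^sup>2) + ennreal (1 / (2 * t y)) * ennreal ((cmod (g y))\<^sup>2)) x"
      by (rule nn_cond_exp_sum) measurable
    moreover have "AE x in M. ennreal (t x / 2) * Esq M F f x = ?E (\<lambda>y. ennreal (t y / 2) * ennreal ((cmod (f y))\<^sup>2)) x"
      unfolding Esq_def by (rule nn_cond_exp_prod) measurable
    moreover have "AE x in M. ennreal (1 / (2 * t x)) * Esq M F g x
        = ?E (\<lambda>y. ennreal (1 / (2 * t y)) * ennreal ((cmod (g y))\<^sup>2)) x"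
      unfolding Esq_def by (rule nn_cond_exp_prod) measurable
    ultimately show ?thesis using f g
    proof eventually_elim
      case (elim x)
      have EA: "Esq M F f x = ennreal (A x)" "Esq M F g x = ennreal (B x)"
        using elim(5,6) by (simp_all add: A_def B_def less_top)
      have "?E (\<lambda>y. ennreal (cmod (f y) * cmod (g y))) x
          \<le> ennreal (t x / 2) * ennreal (A x) + ennreal (1 / (2 * t x)) * ennreal (B x)"
        using elim(1-4) unfolding EA by simp
      also have "\<dots> = ennreal (t x / 2 * A x + 1 / (2 * t x) * B x)"
        using t[of x] AB[of x] by (subst (1 2) ennreal_mult[symmetric]) (auto simp: ennreal_plus[symmetric] simp del: ennreal_plus)
      also have "\<dots> \<le> ennreal (sqrt ((A x + e) * (B x + e)))"
      proof (rule ennreal_leI)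
        have p: "A x + e > 0" "B x + e > 0" using AB[of x] e by linarith+
        have "t x / 2 * A x + 1 / (2 * t x) * B x \<le> t x / 2 * (A x + e) + 1 / (2 * t x) * (B x + e)"
          using t[of x] e by (intro add_mono mult_left_mono) auto
        also have "\<dots> = sqrt ((A x + e) * (B x + e))"
        proof -
          define a b where "a = sqrt (A x + e)" and "b = sqrt (B x + e)"
          have ab: "a > 0" "b > 0" "A x + e = a * a" "B x + e = b * b" using p by (auto simp: a_def b_def)
          have tx: "t x = b / a" using ab by (simp add: t_def real_sqrt_divide real_sqrt_mult)
          show ?thesis unfolding tx ab(3,4) using ab(1,2) by (simp add: real_sqrt_mult field_simps)
        qed
        finally show "t x / 2 * A x + 1 / (2 * t x) * B x \<le> sqrt ((A x + e) * (B x + e))" .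
      qed
      finally show ?case .
    qed
  qed
  \<comment> \<open>Only countably many values of \<open>e\<close> are used, so that their
    exceptional null sets can be united before passing to the limit.\<close>
  have "AE x in M. \<forall>n::nat. ?E (\<lambda>y. ennreal (cmod (f y) * cmod (g y))) x
      \<le> ennreal (sqrt ((A x + 1 / real (Suc n)) * (B x + 1 / real (Suc n))))"
    unfolding AE_all_countable by (intro allI step) simp
  then show ?thesis
    unfolding A_def[symmetric] B_def[symmetric]
  proof eventually_elim
    case (elim x)
    have "(\<lambda>n. ennreal (sqrt ((A x + 1 / real (Suc n)) * (B x + 1 / real (Suc n)))))
        \<longlonglongrightarrow> ennreal (sqrt ((A x + 0) * (B x + 0)))"
      using LIMSEQ_inverse_real_of_nat unfolding inverse_eq_divide
      by (intro tendsto_ennrealI tendsto_real_sqrt tendsto_mult tendsto_add tendsto_const) auto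
    from LIMSEQ_le_const[OF this] elim show ?case by auto
  qed
qed

lemma Esq_finite_domE:
  assumes [measurable]: "f \<in> borel_measurable M" "g \<in> borel_measurable M"
    and "AE x in M. Esq M F f x \<noteq> \<infinity>" "AE x in M. Esq M F g x \<noteq> \<infinity>"
  shows "(\<lambda>x. f x * cnj (g x)) \<in> domE M F"
proof -
  have "AE x in M. nn_cond_exp M F (\<lambda>y. ennreal (cmod (f y) * cmod (g y))) x \<noteq> \<infinity>"
    using nn_cond_exp_Cauchy_Schwarz[OF assms]
    by eventually_elim (metis ennreal_neq_top infinity_ennreal_def top_unique)
  then show ?thesis by (simp add: domE_def norm_mult)
qed

lemma cexp_Cauchy_Schwarz:
  assumes [measurable]: "f \<in> borel_measurable M" "g \<in> borel_measurable M"
    and "AE x in M. Esq M F f x \<noteq> \<infinity>" "AE x in M. Esq M F g x \<noteq> \<infinity>"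
  shows "AE x in M. (cmod (cexp M F (\<lambda>y. f y * cnj (g y)) x))\<^sup>2
    \<le> enn2real (Esq M F f x) * enn2real (Esq M F g x)"
proof -
  have "AE x in M. ennreal (cmod (cexp M F (\<lambda>y. f y * cnj (g y)) x))
      \<le> nn_cond_exp M F (\<lambda>y. ennreal (cmod (f y * cnj (g y)))) x"
    by (rule cmod_cexp_le[OF Esq_finite_domE[OF assms]])
  with nn_cond_exp_Cauchy_Schwarz[OF assms] show ?thesis
  proof eventually_elim
    case (elim x)
    have "ennreal (cmod (cexp M F (\<lambda>y. f y * cnj (g y)) x))
        \<le> ennreal (sqrt (enn2real (Esq M F f x) * enn2real (Esq M F g x)))"
      using order.trans[OF elim(2)[unfolded norm_mult complex_mod_cnj] elim(1)] .
    then have "cmod (cexp M F (\<lambda>y. f y * cnj (g y)) x) \<le> sqrt (enn2real (Esq M F f x) * enn2real (Esq M F g x))"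
      by (simp add: ennreal_le_iff)
    from power_mono[OF this, of 2] show ?case by simp
  qed
qed

section \<open>Multipliers with bounded conditional square\<close>

lemma L2_Esq_finite:
  assumes "f \<in> L2 M"
  shows "AE x in M. Esq M F f x \<noteq> \<infinity>"
proof -
  have [measurable]: "f \<in> borel_measurable M" by (rule L2_measurable[OF assms])
  have "(\<integral>\<^sup>+x. Esq M F f x \<partial>M) \<noteq> \<infinity>"
    using assms unfolding Esq_def L2_iff_nn by (subst nn_cond_exp_one_intg) auto
  then show ?thesis by (intro nn_integral_noteq_infinite) auto
qed

lemma Esq_bddE:
  assumes "Esq_bdd M F p"
  obtains c where "c \<ge> 0" "AE x in M. Esq M F p x \<le> ennreal c"
  using assms unfolding Esq_bdd_def by blast

lemma Esq_bdd_measurable: "Esq_bdd M F p \<Longrightarrow> p \<in> borel_measurable M"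
  by (simp add: Esq_bdd_def)

lemma Esq_bdd_finite:
  assumes "Esq_bdd M F p"
  shows "AE x in M. Esq M F p x \<noteq> \<infinity>"
proof -
  obtain c where "AE x in M. Esq M F p x \<le> ennreal c" using assms by (rule Esq_bddE)
  then show ?thesis by eventually_elim (auto simp: top_unique)
qed

lemma Esq_mult:
  assumes [measurable]: "h \<in> borel_measurable F" "p \<in> borel_measurable M"
  shows "AE x in M. Esq M F (\<lambda>x. p x * h x) x = ennreal ((cmod (h x))\<^sup>2) * Esq M F p x"
proof -
  have [measurable]: "h \<in> borel_measurable M" by (rule F_measurable_M) fact
  have "AE x in M. ennreal ((cmod (h x))\<^sup>2) * Esq M F p x
      = nn_cond_exp M F (\<lambda>x. ennreal ((cmod (h x))\<^sup>2) * ennreal ((cmod (p x))\<^sup>2)) x"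
    unfolding Esq_def by (rule nn_cond_exp_prod) measurable
  moreover have "(\<lambda>x. ennreal ((cmod (h x))\<^sup>2) * ennreal ((cmod (p x))\<^sup>2)) = (\<lambda>x. ennreal ((cmod (p x * h x))\<^sup>2))"
    by (simp add: norm_mult power_mult_distrib ennreal_mult mult.commute)
  ultimately have "AE x in M. ennreal ((cmod (h x))\<^sup>2) * Esq M F p x
      = nn_cond_exp M F (\<lambda>x. ennreal ((cmod (p x * h x))\<^sup>2)) x" by simp
  then show ?thesis by eventually_elim (simp add: Esq_def)
qed

lemma Esq_bdd_mult:
  assumes p: "Esq_bdd M F p" and [measurable]: "h \<in> borel_measurable F"
    and h: "AE x in M. (cmod (h x))\<^sup>2 \<le> d" and d: "d \<ge> 0"
  shows "Esq_bdd M F (\<lambda>x. p x * h x)"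
proof -
  have [measurable]: "p \<in> borel_measurable M" "h \<in> borel_measurable M"
    using p by (auto intro: Esq_bdd_measurable F_measurable_M)
  obtain c where c: "c \<ge> 0" "AE x in M. Esq M F p x \<le> ennreal c" using p by (rule Esq_bddE)
  have "AE x in M. Esq M F (\<lambda>x. p x * h x) x \<le> ennreal (d * c)"
    using Esq_mult[of h p, simplified] c(2) h
    by eventually_elim (auto simp: ennreal_mult d c(1) intro!: mult_mono ennreal_leI)
  moreover have "d * c \<ge> 0" using c(1) d by simp
  ultimately show ?thesis unfolding Esq_bdd_def by (intro conjI exI[of _ "d * c"]) auto
qed

lemma Esq_bdd_mult_L2:
  assumes p: "Esq_bdd M F p" and c: "c \<ge> 0" "AE x in M. Esq M F p x \<le> ennreal c"
    and h: "h \<in> L2 M" and [measurable]: "h \<in> borel_measurable F"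
  shows "(\<lambda>x. p x * h x) \<in> L2 M" "l2_norm M (\<lambda>x. p x * h x) \<le> sqrt c * l2_norm M h"
proof -
  have [measurable]: "p \<in> borel_measurable M" "h \<in> borel_measurable M"
    using p by (auto intro: Esq_bdd_measurable F_measurable_M)
  have "(\<integral>\<^sup>+x. ennreal ((cmod (p x * h x))\<^sup>2) \<partial>M) = (\<integral>\<^sup>+x. Esq M F (\<lambda>x. p x * h x) x \<partial>M)"
    unfolding Esq_def by (rule nn_cond_exp_one_intg[symmetric]) measurable
  also have "\<dots> \<le> (\<integral>\<^sup>+x. ennreal c * ennreal ((cmod (h x))\<^sup>2) \<partial>M)"
  proof (rule nn_integral_mono_AE)
    show "AE x in M. Esq M F (\<lambda>x. p x * h x) x \<le> ennreal c * ennreal ((cmod (h x))\<^sup>2)"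
      using Esq_mult[of h p, simplified] c(2)
    proof eventually_elim
      case (elim x)
      show ?case unfolding elim(1) mult.commute[of _ "Esq M F p x"]
        by (rule mult_right_mono[OF elim(2)]) simp
    qed
  qed
  also have "\<dots> = ennreal c * (\<integral>\<^sup>+x. ennreal ((cmod (h x))\<^sup>2) \<partial>M)"
    by (rule nn_integral_cmult) measurable
  finally have le: "(\<integral>\<^sup>+x. ennreal ((cmod (p x * h x))\<^sup>2) \<partial>M) \<le> \<dots>" .
  show "(\<lambda>x. p x * h x) \<in> L2 M" "l2_norm M (\<lambda>x. p x * h x) \<le> sqrt c * l2_norm M h"
    by (rule l2_norm_scale_le[OF h _ c(1) le]; measurable)+
qed

text \<open>Conditional Cauchy-Schwarz bounds |E(f cnj p)|^2 by c E(|f|^2), and integration removes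
  E.\<close>

lemma cexp_cnj_L2:
  assumes p: "Esq_bdd M F p" and c: "c \<ge> 0" "AE x in M. Esq M F p x \<le> ennreal c" and f: "f \<in> L2 M"
  shows "cexp M F (\<lambda>y. f y * cnj (p y)) \<in> L2 M"
    "l2_norm M (cexp M F (\<lambda>y. f y * cnj (p y))) \<le> sqrt c * l2_norm M f"
proof -
  let ?N = "cexp M F (\<lambda>y. f y * cnj (p y))"
  have [measurable]: "f \<in> borel_measurable M" "p \<in> borel_measurable M"
    using p f by (auto intro: Esq_bdd_measurable L2_measurable)
  have "(\<integral>\<^sup>+x. ennreal ((cmod (?N x))\<^sup>2) \<partial>M) \<le> (\<integral>\<^sup>+x. ennreal c * Esq M F f x \<partial>M)"
  proof (rule nn_integral_mono_AE)
    show "AE x in M. ennreal ((cmod (?N x))\<^sup>2) \<le> ennreal c * Esq M F f x"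
      using cexp_Cauchy_Schwarz[OF _ _ L2_Esq_finite[OF f] Esq_bdd_finite[OF p], simplified] c(2)
        L2_Esq_finite[OF f] Esq_bdd_finite[OF p]
    proof eventually_elim
      case (elim x)
      have "ennreal ((cmod (?N x))\<^sup>2) \<le> ennreal (enn2real (Esq M F f x) * enn2real (Esq M F p x))"
        using elim(1) by (rule ennreal_leI)
      also have "\<dots> = Esq M F p x * Esq M F f x"
        using elim(3,4) by (simp add: ennreal_mult mult.commute less_top)
      also have "\<dots> \<le> ennreal c * Esq M F f x" using elim(2) by (rule mult_right_mono) simp
      finally show ?case .
    qed
  qed
  also have "\<dots> = ennreal c * (\<integral>\<^sup>+x. Esq M F f x \<partial>M)" by (rule nn_integral_cmult) measurable
  also have "(\<integral>\<^sup>+x. Esq M F f x \<partial>M) = (\<integral>\<^sup>+x. ennreal ((cmod (f x))\<^sup>2) \<partial>M)"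
    unfolding Esq_def by (rule nn_cond_exp_one_intg) measurable
  finally have le: "(\<integral>\<^sup>+x. ennreal ((cmod (?N x))\<^sup>2) \<partial>M) \<le> ennreal c * (\<integral>\<^sup>+x. ennreal ((cmod (f x))\<^sup>2) \<partial>M)" .
  show "?N \<in> L2 M" "l2_norm M ?N \<le> sqrt c * l2_norm M f"
    by (rule l2_norm_scale_le[OF f _ c(1) le]; measurable)+
qed

lemma L2_mult_cnj_domE:
  assumes p: "Esq_bdd M F p" and f: "f \<in> L2 M"
  shows "(\<lambda>y. f y * cnj (p y)) \<in> domE M F"
  by (intro Esq_finite_domE L2_measurable[OF f] Esq_bdd_measurable[OF p] L2_Esq_finite[OF f] Esq_bdd_finite[OF p])

lemma cexp_cnj_linear:
  assumes p: "Esq_bdd M F p" and f: "f \<in> L2 M" and g: "g \<in> L2 M"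
  shows "AE x in M. cexp M F (\<lambda>y. (c * f y + g y) * cnj (p y)) x
    = c * cexp M F (\<lambda>y. f y * cnj (p y)) x + cexp M F (\<lambda>y. g y * cnj (p y)) x"
proof -
  have d: "(\<lambda>y. f y * cnj (p y)) \<in> domE M F" "(\<lambda>y. g y * cnj (p y)) \<in> domE M F"
    using p f g by (auto intro: L2_mult_cnj_domE)
  have "AE x in M. cexp M F (\<lambda>y. c * (f y * cnj (p y)) + g y * cnj (p y)) x
      = cexp M F (\<lambda>y. c * (f y * cnj (p y))) x + cexp M F (\<lambda>y. g y * cnj (p y)) x"
    by (intro cexp_add domE_mult d) measurable
  moreover have "AE x in M. cexp M F (\<lambda>y. c * (f y * cnj (p y))) x = c * cexp M F (\<lambda>y. f y * cnj (p y)) x"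
    by (intro cexp_mult d) measurable
  ultimately show ?thesis by eventually_elim (simp add: algebra_simps)
qed

section \<open>Conditional rank-one operators: bounds, adjoints, products\<close>

lemma rank_op_bounded:
  assumes q: "Esq_bdd M F q" and p: "Esq_bdd M F p"
  shows "bounded_op M (rank_op M F q p)"
proof -
  obtain c where c: "c \<ge> 0" "AE x in M. Esq M F p x \<le> ennreal c" using p by (rule Esq_bddE)
  obtain d where d: "d \<ge> 0" "AE x in M. Esq M F q x \<le> ennreal d" using q by (rule Esq_bddE)
  note N = cexp_cnj_L2[OF p c]
  note Q = Esq_bdd_mult_L2[OF q d N(1) cexp_F_measurable]
  have "AE x in M. rank_op M F q p f x = rank_op M F q p g x"
    if "f \<in> L2 M" "g \<in> L2 M" "AE x in M. f x = g x" for f g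
  proof -
    have [measurable]: "f \<in> borel_measurable M" "g \<in> borel_measurable M" "p \<in> borel_measurable M"
      using that p by (auto intro: L2_measurable Esq_bdd_measurable)
    have "AE x in M. f x * cnj (p x) = g x * cnj (p x)" using that(3) by eventually_elim simp
    then have "AE x in M. cexp M F (\<lambda>y. f y * cnj (p y)) x = cexp M F (\<lambda>y. g y * cnj (p y)) x"
      by (rule cexp_cong) measurable
    then show ?thesis by eventually_elim (simp add: rank_op_def)
  qed
  moreover have "AE x in M. rank_op M F q p (\<lambda>y. a * f y + g y) x = a * rank_op M F q p f x + rank_op M F q p g x"
    if "f \<in> L2 M" "g \<in> L2 M" for f g a
    using cexp_cnj_linear[OF p that, of a] by eventually_elim (simp add: rank_op_def algebra_simps)
  moreover have "l2_norm M (rank_op M F q p f) \<le> (sqrt d * sqrt c) * l2_norm M f" if "f \<in> L2 M" for f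
    using order_trans[OF Q(2)[OF that] mult_left_mono[OF N(2)[OF that] real_sqrt_ge_zero[OF d(1)]]]
    by (simp add: rank_op_def mult.assoc)
  moreover have "rank_op M F q p f \<in> L2 M" if "f \<in> L2 M" for f
    using Q(1)[OF that] by (simp add: rank_op_def)
  ultimately show ?thesis unfolding bounded_op_def by blast
qed

text \<open>Since \<open>h\<close> is \<open>F\<close>-measurable, inserting E under the integral
  leaves cnj h outside. Thus h -> p h and f -> E(f cnj p) form an adjoint pair, which makes every
  \<open>rank_op\<close> a product of such a map and an adjoint of one.\<close>

lemma l2_inner_cexp:
  assumes p: "Esq_bdd M F p" and f: "f \<in> L2 M" and h: "h \<in> L2 M" and hF: "h \<in> borel_measurable F"
  shows "l2_inner M f (\<lambda>x. p x * h x) = l2_inner M (cexp M F (\<lambda>y. f y * cnj (p y))) h"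
proof -
  obtain c where c: "c \<ge> 0" "AE x in M. Esq M F p x \<le> ennreal c" using p by (rule Esq_bddE)
  have [measurable]: "h \<in> borel_measurable M" by (rule F_measurable_M) fact
  have hc: "(\<lambda>x. cnj (h x)) \<in> borel_measurable F" using hF by measurable
  have "integrable M (\<lambda>x. f x * cnj (p x * h x))"
    by (rule L2_integrable_mult[OF f Esq_bdd_mult_L2(1)[OF p c h hF]])
  then have i: "integrable M (\<lambda>x. cnj (h x) * (f x * cnj (p x)))" by (simp add: mult_ac)
  have "l2_inner M f (\<lambda>x. p x * h x) = (LINT x|M. cnj (h x) * (f x * cnj (p x)))"
    unfolding l2_inner_def by (simp add: mult_ac)
  also have "\<dots> = (LINT x|M. cexp M F (\<lambda>x. cnj (h x) * (f x * cnj (p x))) x)"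
    by (rule cexp_integral[OF i, symmetric])
  also have "\<dots> = (LINT x|M. cexp M F (\<lambda>y. f y * cnj (p y)) x * cnj (h x))"
    using cexp_mult[OF hc L2_mult_cnj_domE[OF p f]]
    by (intro integral_cong_AE) (auto elim: eventually_mono simp: mult.commute)
  finally show ?thesis unfolding l2_inner_def .
qed

lemma rank_op_inner:
  assumes q: "Esq_bdd M F q" and p: "Esq_bdd M F p" and f: "f \<in> L2 M" and g: "g \<in> L2 M"
  shows "l2_inner M (rank_op M F q p f) g
    = l2_inner M (cexp M F (\<lambda>y. f y * cnj (p y))) (cexp M F (\<lambda>y. g y * cnj (q y)))"
proof -
  obtain c where c: "c \<ge> 0" "AE x in M. Esq M F p x \<le> ennreal c" using p by (rule Esq_bddE)
  have "l2_inner M (rank_op M F q p f) g = cnj (l2_inner M g (\<lambda>x. q x * cexp M F (\<lambda>y. f y * cnj (p y)) x))"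
    unfolding rank_op_def by (rule l2_inner_commute)
  also have "\<dots> = cnj (l2_inner M (cexp M F (\<lambda>y. g y * cnj (q y))) (cexp M F (\<lambda>y. f y * cnj (p y))))"
    by (simp add: l2_inner_cexp[OF q g cexp_cnj_L2(1)[OF p c f] cexp_F_measurable])
  finally show ?thesis by (simp add: l2_inner_commute[of M "cexp M F (\<lambda>y. f y * cnj (p y))"])
qed

lemma rank_op_adjoint:
  assumes q: "Esq_bdd M F q" and p: "Esq_bdd M F p"
  shows "is_adjoint M (rank_op M F q p) (rank_op M F p q)"
  unfolding is_adjoint_def
proof (intro conjI ballI)
  show "bounded_op M (rank_op M F p q)" by (rule rank_op_bounded[OF p q])
  fix f g assume f: "f \<in> L2 M" and g: "g \<in> L2 M"
  have "l2_inner M f (rank_op M F p q g) = cnj (l2_inner M (rank_op M F p q g) f)"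
    by (rule l2_inner_commute)
  then show "l2_inner M (rank_op M F q p f) g = l2_inner M f (rank_op M F p q g)"
    by (simp add: rank_op_inner p q f g l2_inner_commute[symmetric])
qed

lemma cexp_cnj_bdd:
  assumes q: "Esq_bdd M F q" and p: "Esq_bdd M F p"
  shows "\<exists>d\<ge>0. AE x in M. (cmod (cexp M F (\<lambda>y. q y * cnj (p y)) x))\<^sup>2 \<le> d"
proof -
  obtain c where c: "c \<ge> 0" "AE x in M. Esq M F p x \<le> ennreal c" using p by (rule Esq_bddE)
  obtain d where d: "d \<ge> 0" "AE x in M. Esq M F q x \<le> ennreal d" using q by (rule Esq_bddE)
  have "AE x in M. (cmod (cexp M F (\<lambda>y. q y * cnj (p y)) x))\<^sup>2 \<le> d * c"
    using cexp_Cauchy_Schwarz[OF Esq_bdd_measurable[OF q] Esq_bdd_measurable[OF p]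
        Esq_bdd_finite[OF q] Esq_bdd_finite[OF p]] c(2) d(2)
  proof eventually_elim
    case (elim x)
    have "enn2real (Esq M F p x) \<le> c" "enn2real (Esq M F q x) \<le> d"
      using elim(2,3) c(1) d(1) by (auto intro: enn2real_leI)
    then show ?case using elim(1) c(1) d(1) by (meson enn2real_nonneg mult_mono order_trans)
  qed
  then show ?thesis using c d by (intro exI[of _ "d * c"]) auto
qed

text \<open>The inner operator multiplies \<open>q'\<close> by an \<open>F\<close>-measurable
  function, which leaves the outer E; so products of rank-one type stay of rank-one type with the
  same right-hand vector \<open>p'\<close>.\<close>

lemma rank_op_comp:
  assumes q: "Esq_bdd M F q" and p: "Esq_bdd M F p" and q': "Esq_bdd M F q'" and p': "Esq_bdd M F p'"
  defines "r \<equiv> (\<lambda>x. q x * cexp M F (\<lambda>y. q' y * cnj (p y)) x)"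
  shows "Esq_bdd M F r" "op_eq M (rank_op M F q p \<circ> rank_op M F q' p') (rank_op M F r p')"
proof -
  show "Esq_bdd M F r"
    unfolding r_def using cexp_cnj_bdd[OF q' p] Esq_bdd_mult[OF q cexp_F_measurable] by blast
  have d: "(\<lambda>y. q' y * cnj (p y)) \<in> domE M F"
    by (intro Esq_finite_domE Esq_bdd_measurable Esq_bdd_finite q' p)
  show "op_eq M (rank_op M F q p \<circ> rank_op M F q' p') (rank_op M F r p')"
    unfolding op_eq_def
  proof
    fix f assume f: "f \<in> L2 M"
    have "AE x in M. cexp M F (\<lambda>y. cexp M F (\<lambda>y. f y * cnj (p' y)) y * (q' y * cnj (p y))) x
        = cexp M F (\<lambda>y. f y * cnj (p' y)) x * cexp M F (\<lambda>y. q' y * cnj (p y)) x"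
      by (intro cexp_mult d cexp_F_measurable)
    then show "AE x in M. (rank_op M F q p \<circ> rank_op M F q' p') f x = rank_op M F r p' f x"
      by eventually_elim (simp add: rank_op_def r_def mult_ac)
  qed
qed

text \<open>Localisation to the sets in \<open>F\<close> of finite measure on which the claim fails.
  The constant bound makes the integral of \<open>g\<close> over such a set finite, so a strict
  pointwise inequality would give a strict inequality of integrals. The premise
  \<open>g x < f x\<close> on \<open>A\<close> is handed to the user of the rule, who may exploit
  it.\<close>

lemma AE_le_if_set_nn_integral_le:
  fixes f g :: "'a \<Rightarrow> ennreal" and c :: real
  assumes [measurable]: "f \<in> borel_measurable F" "g \<in> borel_measurable F"
    and c: "AE x in M. g x \<le> ennreal c"
    and le: "\<And>A. \<lbrakk>A \<in> sets F; emeasure M A < \<infinity>; \<And>x. x \<in> A \<Longrightarrow> g x < f x\<rbrakk>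
      \<Longrightarrow> (\<integral>\<^sup>+x. f x * indicator A x \<partial>M) \<le> (\<integral>\<^sup>+x. g x * indicator A x \<partial>M)"
  shows "AE x in M. f x \<le> g x"
proof -
  interpret R: sigma_finite_measure "restr_to_subalg M F" by (rule sigma_fin_subalg)
  obtain A :: "nat \<Rightarrow> 'a set" where A: "range A \<subseteq> sets (restr_to_subalg M F)"
    "(\<Union>i. A i) = space (restr_to_subalg M F)" "\<And>i. emeasure (restr_to_subalg M F) (A i) \<noteq> \<infinity>"
    by (rule R.sigma_finite) blast
  have AF[measurable]: "A i \<in> sets F" for i
    using A(1) by (auto simp: sets_restr_to_subalg[OF subalg])
  have fM[measurable]: "f \<in> borel_measurable M" and gM[measurable]: "g \<in> borel_measurable M"
    by (auto intro: F_measurable_M)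
  have spF: "space F = space M" using subalg by (simp add: subalgebra_def)
  have "AE x in M. x \<in> A i \<longrightarrow> f x \<le> g x" for i
  proof -
    define D where "D = {x \<in> space F. x \<in> A i \<and> g x < f x}"
    have DF: "D \<in> sets F" unfolding D_def by measurable
    then have DM[measurable]: "D \<in> sets M" using subalg by (auto simp: subalgebra_def)
    have "emeasure M D \<le> emeasure M (A i)"
      using AF[of i] subalg by (intro emeasure_mono) (auto simp: D_def subalgebra_def)
    also have "\<dots> < \<infinity>"
      using A(3)[of i] AF[of i] by (simp add: emeasure_restr_to_subalg[OF subalg] less_top)
    finally have fin: "emeasure M D < \<infinity>" .
    have "(\<integral>\<^sup>+x. g x * indicator D x \<partial>M) \<le> (\<integral>\<^sup>+x. ennreal c * indicator D x \<partial>M)"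
      using c by (intro nn_integral_mono_AE) (auto elim!: eventually_mono intro: mult_right_mono)
    also have "\<dots> < \<infinity>" using fin by (simp add: nn_integral_cmult_indicator ennreal_mult_less_top)
    finally have gfin: "(\<integral>\<^sup>+x. g x * indicator D x \<partial>M) \<noteq> \<infinity>" by simp
    have "AE x in M. f x * indicator D x \<le> g x * indicator D x"
    proof (rule ccontr)
      assume "\<not> (AE x in M. f x * indicator D x \<le> g x * indicator D x)"
      then have "(\<integral>\<^sup>+x. g x * indicator D x \<partial>M) < (\<integral>\<^sup>+x. f x * indicator D x \<partial>M)"
        by (intro nn_integral_less[OF _ _ gfin] borel_measurable_times_ennreal borel_measurable_indicator DM fM gM)
          (auto simp: D_def indicator_def)
      moreover have "(\<integral>\<^sup>+x. f x * indicator D x \<partial>M) \<le> (\<integral>\<^sup>+x. g x * indicator D x \<partial>M)"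
        by (rule le[OF DF fin]) (simp add: D_def)
      ultimately show False by simp
    qed
    then show ?thesis
      using AE_space
    proof eventually_elim
      case (elim x)
      then show ?case by (cases "x \<in> D") (auto simp: D_def spF not_less)
    qed
  qed
  then have "AE x in M. \<forall>i. x \<in> A i \<longrightarrow> f x \<le> g x" by (intro AE_all_countable[THEN iffD2] allI)
  then show ?thesis
    using AE_space
  proof eventually_elim
    case (elim x)
    then have "x \<in> (\<Union>i. A i)" using A(2) by (simp add: space_restr_to_subalg)
    then show ?case using elim(1) by blast
  qed
qed

text \<open>True also where E(|p|^2) is infinite, since both sides take the default value 0
  there.\<close>

lemma cexp_mult_cnj_self:
  assumes [measurable]: "p \<in> borel_measurable M"
  shows "AE x in M. cexp M F (\<lambda>y. p y * cnj (p y)) x = of_real (enn2real (Esq M F p x))"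
proof -
  have "AE x in M. 0 = nn_cond_exp M F (\<lambda>_. 0) x" by (rule nn_cond_exp_F_meas) simp
  then show ?thesis
  proof eventually_elim
    case (elim x)
    have e: "p y * cnj (p y) = of_real ((cmod (p y))\<^sup>2)" for y by (rule complex_norm_square[symmetric])
    have n: "ennreal (- ((cmod (p y))\<^sup>2)) = 0" for y by (simp add: ennreal_neg)
    show ?case
      unfolding cexp_def e Re_complex_of_real Im_complex_of_real real_cond_exp_def Esq_def n
      by (simp add: elim[symmetric] complex_eq_iff)
  qed
qed

text \<open>The zero set of E(|p|^2) is \<open>F\<close>-measurable, so |p|^2 has integral 0 over
  it.\<close>

lemma Esq_eq_0_imp:
  assumes [measurable]: "p \<in> borel_measurable M"
  shows "AE x in M. Esq M F p x = 0 \<longrightarrow> p x = 0"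
proof -
  define d :: "'a \<Rightarrow> ennreal" where "d x = (if Esq M F p x = 0 then 1 else 0)" for x
  have [measurable]: "d \<in> borel_measurable F" unfolding d_def by measurable
  have [measurable]: "d \<in> borel_measurable M" by (rule F_measurable_M) fact
  have "(\<integral>\<^sup>+x. d x * ennreal ((cmod (p x))\<^sup>2) \<partial>M) = (\<integral>\<^sup>+x. d x * Esq M F p x \<partial>M)"
    unfolding Esq_def by (rule nn_cond_exp_intg[symmetric]) measurable
  also have "\<dots> = (\<integral>\<^sup>+x. 0 \<partial>M)" by (rule nn_integral_cong) (simp add: d_def)
  finally have "AE x in M. d x * ennreal ((cmod (p x))\<^sup>2) = 0"
    by (simp add: nn_integral_0_iff_AE)
  then show ?thesis by eventually_elim (auto simp: d_def ennreal_eq_0_iff)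
qed

lemma cexp_eq_0_on:
  assumes [measurable]: "Measurable.pred F P" "g \<in> borel_measurable M"
    and ae: "AE x in M. P x \<longrightarrow> g x = 0"
  shows "AE x in M. P x \<longrightarrow> cexp M F g x = 0"
proof -
  define d where "d x = (if P x then 1 else 0 :: real)" for x
  have [measurable]: "d \<in> borel_measurable F" unfolding d_def by measurable
  have [measurable]: "d \<in> borel_measurable M" by (rule F_measurable_M) fact
  have "AE x in M. of_real (d x) * g x = 0 * 0" using ae by eventually_elim (simp add: d_def)
  then have "AE x in M. cexp M F (\<lambda>x. of_real (d x) * g x) x = cexp M F (\<lambda>x. of_real 0 * 0) x"
    by (intro cexp_cong) (auto simp del: mult_zero_left)
  \<comment> \<open>The zero function is written as a product so that E 0 = 0 follows by pulling out
    the factor 0.\<close>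
  moreover have "AE x in M. cexp M F (\<lambda>x. of_real 0 * 0) x = of_real 0 * cexp M F (\<lambda>x. 0) x"
    by (rule cexp_mult_real) measurable
  moreover have "AE x in M. cexp M F (\<lambda>x. of_real (d x) * g x) x = of_real (d x) * cexp M F g x"
    by (rule cexp_mult_real) measurable
  ultimately show ?thesis by eventually_elim (auto simp: d_def)
qed

lemma rank_op_cong:
  "AE x in M. q x = q' x \<Longrightarrow> op_eq M (rank_op M F q p) (rank_op M F q' p)"
  unfolding op_eq_def rank_op_def by (intro ballI) (auto elim: eventually_mono)

text \<open>Pulling the real multiplier \<open>s\<close> out of the second E leaves an integral of
  \<open>s\<close> against |E(f cnj e)|^2. This reduces positivity and order of such operators to
  properties of the multiplier.\<close>

lemma rank_op_quadratic:
  assumes e: "Esq_bdd M F e" and [measurable]: "s \<in> borel_measurable F"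
    and es: "Esq_bdd M F (\<lambda>x. e x * of_real (s x))" and f: "f \<in> L2 M"
  shows "l2_inner M (rank_op M F (\<lambda>x. e x * of_real (s x)) e f) f
    = of_real (LINT x|M. s x * (cmod (cexp M F (\<lambda>y. f y * cnj (e y)) x))\<^sup>2)"
proof -
  have [measurable]: "f \<in> borel_measurable M" "e \<in> borel_measurable M" "s \<in> borel_measurable M"
    using e f by (auto intro: Esq_bdd_measurable L2_measurable F_measurable_M)
  let ?N = "cexp M F (\<lambda>y. f y * cnj (e y))"
  have "l2_inner M (rank_op M F (\<lambda>x. e x * of_real (s x)) e f) f
      = l2_inner M ?N (cexp M F (\<lambda>y. f y * cnj (e y * of_real (s y))))"
    by (rule rank_op_inner[OF es e f f])
  also have "\<dots> = (LINT x|M. ?N x * cnj (cexp M F (\<lambda>y. of_real (s y) * (f y * cnj (e y))) x))"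
    unfolding l2_inner_def by (simp add: mult_ac)
  also have "\<dots> = (LINT x|M. of_real (s x * (cmod (?N x))\<^sup>2))"
  proof (rule integral_cong_AE)
    have "AE x in M. cexp M F (\<lambda>y. of_real (s y) * (f y * cnj (e y))) x = of_real (s x) * ?N x"
      by (rule cexp_mult_real) measurable
    then show "AE x in M. ?N x * cnj (cexp M F (\<lambda>y. of_real (s y) * (f y * cnj (e y))) x)
        = of_real (s x * (cmod (?N x))\<^sup>2)"
      by eventually_elim (simp add: complex_norm_square mult_ac del: of_real_power)
  qed measurable
  also have "\<dots> = of_real (LINT x|M. s x * (cmod (?N x))\<^sup>2)" by (rule integral_complex_of_real)
  finally show ?thesis .
qed

text \<open>By \<open>e1\<close> the operator \<open>rank_op M F e e\<close> is an orthogonal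
  projection. The adjoint of T times T is this projection multiplied by E(|p|^2), so the root is
  taken in the multiplier alone. T is given only up to \<open>op_eq\<close> so that the lemma
  applies to T and to its square.\<close>

lemma rank_op_abs:
  assumes p: "Esq_bdd M F p" and e: "Esq_bdd M F e"
    and T: "bounded_op M T" and eq: "op_eq M T (rank_op M F p e)"
    and e1: "AE x in M. e x \<noteq> 0 \<longrightarrow> Esq M F e x = 1"
  defines "s \<equiv> (\<lambda>x. sqrt (enn2real (Esq M F p x)))"
  shows "Esq_bdd M F (\<lambda>x. e x * of_real (s x))"
    and "Esq_bdd M F (\<lambda>x. e x * of_real ((s x)\<^sup>2))"
    and "positive_op M (op_abs M T)"
    and "op_eq M (op_abs M T) (rank_op M F (\<lambda>x. e x * of_real (s x)) e)"
    and "op_eq M (op_abs M T \<circ> op_abs M T) (rank_op M F (\<lambda>x. e x * of_real ((s x)\<^sup>2)) e)"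
proof -
  have [measurable]: "s \<in> borel_measurable F" unfolding s_def by measurable
  have [measurable]: "p \<in> borel_measurable M" "e \<in> borel_measurable M"
    using p e by (auto intro: Esq_bdd_measurable)
  obtain c where c: "c \<ge> 0" "AE x in M. Esq M F p x \<le> ennreal c" using p by (rule Esq_bddE)
  have sc: "AE x in M. (s x)\<^sup>2 \<le> c"
    using c(2) by eventually_elim (auto simp: s_def enn2real_leI c(1))
  show es: "Esq_bdd M F (\<lambda>x. e x * of_real (s x))"
    by (rule Esq_bdd_mult[OF e _ _ c(1)]) (use sc in \<open>auto\<close>)
  have "AE x in M. (cmod (of_real ((s x)\<^sup>2)))\<^sup>2 \<le> c\<^sup>2"
    using sc
  proof eventually_elim
    case (elim x)
    have n: "cmod (of_real ((s x)\<^sup>2)) = (s x)\<^sup>2" by (simp add: norm_power)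
    show ?case unfolding n by (rule power_mono[OF elim]) simp
  qed
  then show es2: "Esq_bdd M F (\<lambda>x. e x * of_real ((s x)\<^sup>2))"
    by (intro Esq_bdd_mult[OF e]) auto
  define R where "R = rank_op M F (\<lambda>x. e x * of_real (s x)) e"
  have bR: "bounded_op M R" unfolding R_def by (rule rank_op_bounded[OF es e])
  have posR: "positive_op M R"
    unfolding positive_op_def
  proof (intro conjI ballI bR)
    fix f assume f: "f \<in> L2 M"
    show "Im (l2_inner M (R f) f) = 0" "Re (l2_inner M (R f) f) \<ge> 0"
      unfolding R_def rank_op_quadratic[OF e _ es f, simplified]
      by (auto intro!: integral_nonneg_AE simp: s_def)
  qed
  \<comment> \<open>This is the idempotence of the projection: E(|e|^2) is 1 wherever
    \<open>e\<close> is nonzero.\<close>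
  have ee: "AE x in M. e x * cexp M F (\<lambda>y. e y * cnj (e y)) x = e x"
    using cexp_mult_cnj_self[of e, simplified] e1 by eventually_elim auto
  have RR: "op_eq M (R \<circ> R) (rank_op M F (\<lambda>x. e x * of_real ((s x)\<^sup>2)) e)"
  proof -
    have "AE x in M. cexp M F (\<lambda>y. of_real (s y) * (e y * cnj (e y))) x
        = of_real (s x) * cexp M F (\<lambda>y. e y * cnj (e y)) x"
      by (rule cexp_mult_real) measurable
    with ee have "AE x in M. e x * of_real (s x) * cexp M F (\<lambda>y. e y * of_real (s y) * cnj (e y)) x
        = e x * of_real ((s x)\<^sup>2)"
    proof eventually_elim
      case (elim x)
      have "e x * of_real (s x) * cexp M F (\<lambda>y. e y * of_real (s y) * cnj (e y)) x
          = of_real (s x) * of_real (s x) * (e x * cexp M F (\<lambda>y. e y * cnj (e y)) x)"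
        using elim(2) by (simp add: mult_ac)
      then show ?case unfolding elim(1) by (simp add: power2_eq_square mult_ac)
    qed
    then show ?thesis
      unfolding R_def by (rule op_eq_trans[OF rank_op_comp(2)[OF es e es e] rank_op_cong])
  qed
  have adj: "is_adjoint M T (rank_op M F e p)"
    unfolding is_adjoint_def
  proof (intro conjI ballI)
    show "bounded_op M (rank_op M F e p)" by (rule rank_op_bounded[OF e p])
    fix f g assume f: "f \<in> L2 M" and g: "g \<in> L2 M"
    have "l2_inner M (T f) g = l2_inner M (rank_op M F p e f) g"
      by (rule l2_inner_cong[OF _ _ bounded_op_L2[OF T f] bounded_op_L2[OF rank_op_bounded[OF p e] f] g g])
        (use eq f in \<open>auto simp: op_eq_def\<close>)
    also have "\<dots> = l2_inner M f (rank_op M F e p g)"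
      using rank_op_adjoint[OF p e] f g by (simp add: is_adjoint_def)
    finally show "l2_inner M (T f) g = l2_inner M f (rank_op M F e p g)" .
  qed
  note [trans] = op_eq_trans
  have "op_eq M (rank_op M F e p \<circ> T) (rank_op M F e p \<circ> rank_op M F p e)"
    by (rule op_eq_comp[OF _ eq rank_op_bounded[OF e p] T rank_op_bounded[OF p e]])
      (simp add: op_eq_def)
  also have "op_eq M \<dots> (rank_op M F (\<lambda>x. e x * cexp M F (\<lambda>y. p y * cnj (p y)) x) e)"
    by (rule rank_op_comp(2)[OF e p p e])
  also have "op_eq M \<dots> (rank_op M F (\<lambda>x. e x * of_real ((s x)\<^sup>2)) e)"
    by (rule rank_op_cong) (use cexp_mult_cnj_self[of p, simplified] in \<open>eventually_elim, simp add: s_def\<close>)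
  finally have ST: "op_eq M (rank_op M F e p \<circ> T) (rank_op M F (\<lambda>x. e x * of_real ((s x)\<^sup>2)) e)" .
  have RST: "op_eq M (R \<circ> R) (rank_op M F e p \<circ> T)" by (rule op_eq_trans[OF RR op_eq_sym[OF ST]])
  note absR = op_abs_eqI[OF T adj posR RST]
  show pos: "positive_op M (op_abs M T)" by (rule absR)
  show aR: "op_eq M (op_abs M T) (rank_op M F (\<lambda>x. e x * of_real (s x)) e)"
    using absR(2) by (simp add: R_def)
  have bA: "bounded_op M (op_abs M T)" using pos by (simp add: positive_op_def)
  show "op_eq M (op_abs M T \<circ> op_abs M T) (rank_op M F (\<lambda>x. e x * of_real ((s x)\<^sup>2)) e)"
    by (rule op_eq_trans[OF op_eq_comp[OF absR(2) absR(2) bR bA bR] RR])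
qed

text \<open>The quadratic forms see a multiplier only where E(|e|^2) is nonzero. By
  \<open>v1\<close> the multiplier \<open>s\<close>, and with it \<open>t\<close> = |b| s, vanishes
  wherever E(|e|^2) differs from 1, so the comparison of forms loses nothing.\<close>

lemma rank_op_A_class_iff:
  assumes v: "Esq_bdd M F v" and e: "Esq_bdd M F e"
    and T: "bounded_op M T" and eq: "op_eq M T (rank_op M F v e)"
    and e1: "AE x in M. e x \<noteq> 0 \<longrightarrow> Esq M F e x = 1"
    and v1: "AE x in M. Esq M F v x \<noteq> 0 \<longrightarrow> Esq M F e x = 1"
  shows "A_class M T \<longleftrightarrow>
    (AE x in M. enn2real (Esq M F v x) \<le> (cmod (cexp M F (\<lambda>y. v y * cnj (e y)) x))\<^sup>2)"
proof -
  have [measurable]: "v \<in> borel_measurable M" "e \<in> borel_measurable M"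
    using v e by (auto intro: Esq_bdd_measurable)
  define b where "b = cexp M F (\<lambda>y. v y * cnj (e y))"
  define vb where "vb = (\<lambda>x. v x * b x)"
  define s where "s x = sqrt (enn2real (Esq M F v x))" for x
  define t where "t x = sqrt (enn2real (Esq M F vb x))" for x
  have [measurable]: "b \<in> borel_measurable F" "s \<in> borel_measurable F" "t \<in> borel_measurable F"
    unfolding b_def s_def t_def by measurable
  have [measurable]: "s \<in> borel_measurable M" "t \<in> borel_measurable M" by (auto intro: F_measurable_M)
  have bve: "bounded_op M (rank_op M F v e)" by (rule rank_op_bounded[OF v e])
  have vb: "Esq_bdd M F vb" unfolding vb_def b_def by (rule rank_op_comp(1)[OF v e v e])
  have TT: "op_eq M (T \<circ> T) (rank_op M F vb e)"
    unfolding vb_def b_def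
    by (rule op_eq_trans[OF op_eq_comp[OF eq eq bve T bve] rank_op_comp(2)[OF v e v e]])
  note A1 = rank_op_abs[OF v e T eq e1, folded s_def]
  note A2 = rank_op_abs[OF vb e bounded_op_comp[OF T T] TT e1, folded t_def]
  define P where "P = op_abs M T \<circ> op_abs M T"
  define Q where "Q = op_abs M (T \<circ> T)"
  have bP: "bounded_op M P" and bQ: "bounded_op M Q"
    using A1(3) A2(3) by (auto simp: P_def Q_def positive_op_def intro: bounded_op_comp)
  define N where "N f = cexp M F (\<lambda>y. f y * cnj (e y))" for f
  obtain c where c: "c \<ge> 0" "AE x in M. Esq M F v x \<le> ennreal c" using v by (rule Esq_bddE)
  obtain d where d: "d \<ge> 0" "AE x in M. Esq M F vb x \<le> ennreal d" using vb by (rule Esq_bddE)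
  obtain k where k: "k \<ge> 0" "AE x in M. Esq M F e x \<le> ennreal k" using e by (rule Esq_bddE)
  have sc: "AE x in M. (s x)\<^sup>2 \<le> c"
    using c(2) by eventually_elim (auto simp: s_def enn2real_leI c(1))
  have td: "AE x in M. t x \<le> sqrt d"
    using d(2) by eventually_elim (auto simp: t_def enn2real_leI d(1))
  have NL2: "N f \<in> L2 M" if "f \<in> L2 M" for f unfolding N_def by (rule cexp_cnj_L2(1)[OF e k that])
  have int: "integrable M (\<lambda>x. r x * (cmod (N f x))\<^sup>2)"
    if "f \<in> L2 M" "AE x in M. r x \<le> C" "\<And>x. r x \<ge> 0" "r \<in> borel_measurable M" for f r C
  proof (rule Bochner_Integration.integrable_bound)
    show "integrable M (\<lambda>x. C * (cmod (N f x))\<^sup>2)" using NL2[OF that(1)] by (simp add: L2_def)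
    have [measurable]: "N f \<in> borel_measurable M" by (rule L2_measurable[OF NL2[OF that(1)]])
    show "(\<lambda>x. r x * (cmod (N f x))\<^sup>2) \<in> borel_measurable M" using that(4) by measurable
    show "AE x in M. norm (r x * (cmod (N f x))\<^sup>2) \<le> norm (C * (cmod (N f x))\<^sup>2)"
      using that(2)
    proof eventually_elim
      case (elim x)
      then show ?case using that(3)[of x] by (auto simp: abs_mult intro!: mult_right_mono)
    qed
  qed
  have intS: "integrable M (\<lambda>x. (s x)\<^sup>2 * (cmod (N f x))\<^sup>2)" if "f \<in> L2 M" for f
    by (rule int[OF that sc]) auto
  have intT: "integrable M (\<lambda>x. t x * (cmod (N f x))\<^sup>2)" if "f \<in> L2 M" for f
    by (rule int[OF that td]) (auto simp: t_def)
  have quad: "l2_inner M (\<lambda>x. Q f x - P f x) f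
      = of_real ((LINT x|M. t x * (cmod (N f x))\<^sup>2) - (LINT x|M. (s x)\<^sup>2 * (cmod (N f x))\<^sup>2))"
    if f: "f \<in> L2 M" for f
  proof -
    have "l2_inner M (Q f) f = l2_inner M (rank_op M F (\<lambda>x. e x * of_real (t x)) e f) f"
      by (rule l2_inner_cong[OF _ _ bounded_op_L2[OF bQ f] bounded_op_L2[OF rank_op_bounded[OF A2(1) e] f] f f])
        (use A2(4) f in \<open>auto simp: op_eq_def Q_def\<close>)
    moreover have "l2_inner M (P f) f = l2_inner M (rank_op M F (\<lambda>x. e x * of_real ((s x)\<^sup>2)) e f) f"
      by (rule l2_inner_cong[OF _ _ bounded_op_L2[OF bP f] bounded_op_L2[OF rank_op_bounded[OF A1(2) e] f] f f])
        (use A1(5) f in \<open>auto simp: op_eq_def P_def\<close>)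
    moreover have "l2_inner M (rank_op M F (\<lambda>x. e x * of_real (t x)) e f) f
        = of_real (LINT x|M. t x * (cmod (N f x))\<^sup>2)"
      unfolding N_def by (rule rank_op_quadratic[OF e _ A2(1) f]) measurable
    moreover have "l2_inner M (rank_op M F (\<lambda>x. e x * of_real ((s x)\<^sup>2)) e f) f
        = of_real (LINT x|M. (s x)\<^sup>2 * (cmod (N f x))\<^sup>2)"
      unfolding N_def by (rule rank_op_quadratic[OF e _ A1(2) f]) measurable
    ultimately show ?thesis
      by (simp add: l2_inner_diff[OF bounded_op_L2[OF bQ f] bounded_op_L2[OF bP f] f])
  qed
  have A: "A_class M T \<longleftrightarrow> (\<forall>f\<in>L2 M. (LINT x|M. (s x)\<^sup>2 * (cmod (N f x))\<^sup>2) \<le> (LINT x|M. t x * (cmod (N f x))\<^sup>2))"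
    unfolding A_class_def op_le_def P_def[symmetric] Q_def[symmetric] positive_op_def
    using bounded_op_diff[OF bQ bP] quad by simp
  have B: "(\<forall>f\<in>L2 M. (LINT x|M. (s x)\<^sup>2 * (cmod (N f x))\<^sup>2) \<le> (LINT x|M. t x * (cmod (N f x))\<^sup>2))
      \<longleftrightarrow> (AE x in M. (s x)\<^sup>2 \<le> t x)"
  proof
    assume ae: "AE x in M. (s x)\<^sup>2 \<le> t x"
    show "\<forall>f\<in>L2 M. (LINT x|M. (s x)\<^sup>2 * (cmod (N f x))\<^sup>2) \<le> (LINT x|M. t x * (cmod (N f x))\<^sup>2)"
    proof
      fix f assume f: "f \<in> L2 M"
      show "(LINT x|M. (s x)\<^sup>2 * (cmod (N f x))\<^sup>2) \<le> (LINT x|M. t x * (cmod (N f x))\<^sup>2)"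
        using ae by (intro integral_mono_AE intS intT f) (auto elim!: eventually_mono intro: mult_right_mono)
    qed
  next
    assume le: "\<forall>f\<in>L2 M. (LINT x|M. (s x)\<^sup>2 * (cmod (N f x))\<^sup>2) \<le> (LINT x|M. t x * (cmod (N f x))\<^sup>2)"
    have "AE x in M. ennreal ((s x)\<^sup>2) \<le> ennreal (t x)"
    proof (rule AE_le_if_set_nn_integral_le[where c = "sqrt d"])
      show "AE x in M. ennreal (t x) \<le> ennreal (sqrt d)" using td by eventually_elim (rule ennreal_leI)
      fix A assume AF[measurable]: "A \<in> sets F" and fin: "emeasure M A < \<infinity>"
        and less: "\<And>x. x \<in> A \<Longrightarrow> ennreal (t x) < ennreal ((s x)\<^sup>2)"
      have AM[measurable]: "A \<in> sets M" using AF subalg by (auto simp: subalgebra_def)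
      define h where "h x = complex_of_real (indicator A x)" for x
      have hF[measurable]: "h \<in> borel_measurable F" unfolding h_def by measurable
      have [measurable]: "h \<in> borel_measurable M" by (rule F_measurable_M) fact
      have hA: "ennreal ((cmod (h x))\<^sup>2) = indicator A x" for x by (simp add: h_def indicator_def)
      have hL: "h \<in> L2 M"
        using fin unfolding L2_iff_nn hA by simp
      \<comment> \<open>The test function that isolates \<open>A\<close>: N f is the indicator of
        \<open>A\<close> times E(|e|^2).\<close>
      define f where "f x = e x * h x" for x
      have fL: "f \<in> L2 M" unfolding f_def by (rule Esq_bdd_mult_L2(1)[OF e k hL hF])
      \<comment> \<open>The factor \<open>s x\<close> restricts the first equation to points where
        \<open>v1\<close> supplies E(|e|^2) = 1; \<open>spos\<close> cancels it on \<open>A\<close>,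
        where \<open>less\<close> excludes \<open>s x = 0\<close>.\<close>
      have Nf: "AE x in M. indicator A x * s x * (cmod (N f x))\<^sup>2 = indicator A x * s x
          \<and> (x \<notin> A \<longrightarrow> N f x = 0)"
      proof -
        have "AE x in M. cexp M F (\<lambda>y. of_real (indicator A y) * (e y * cnj (e y))) x
            = of_real (indicator A x) * cexp M F (\<lambda>y. e y * cnj (e y)) x"
          by (rule cexp_mult_real) measurable
        with v1 cexp_mult_cnj_self[of e, simplified] show ?thesis
        proof eventually_elim
          case (elim x)
          have "N f x = of_real (indicator A x) * of_real (enn2real (Esq M F e x))"
            using elim by (simp add: N_def f_def h_def mult_ac)
          then show ?case using elim(1) by (cases "Esq M F v x = 0") (auto simp: s_def indicator_def)
        qed
      qed
      have spos: "s x > 0" if "x \<in> A" for x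
      proof -
        have "s x \<ge> 0" by (simp add: s_def)
        then show ?thesis using less[OF that] by (cases "s x = 0") auto
      qed
      from Nf have Nf1: "AE x in M. (cmod (N f x))\<^sup>2 = indicator A x"
      proof eventually_elim
        case (elim x)
        then show ?case by (cases "x \<in> A") (auto dest: spos)
      qed
      have S: "(\<integral>\<^sup>+x. ennreal ((s x)\<^sup>2) * indicator A x \<partial>M) = ennreal (LINT x|M. (s x)\<^sup>2 * (cmod (N f x))\<^sup>2)"
        by (subst nn_integral_eq_integral[symmetric, OF intS[OF fL]])
          (use Nf1 in \<open>auto intro!: nn_integral_cong_AE elim!: eventually_mono simp: indicator_def\<close>)
      have T: "(\<integral>\<^sup>+x. ennreal (t x) * indicator A x \<partial>M) = ennreal (LINT x|M. t x * (cmod (N f x))\<^sup>2)"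
        by (subst nn_integral_eq_integral[symmetric, OF intT[OF fL]])
          (use Nf1 in \<open>auto intro!: nn_integral_cong_AE elim!: eventually_mono simp: indicator_def t_def\<close>)
      show "(\<integral>\<^sup>+x. ennreal ((s x)\<^sup>2) * indicator A x \<partial>M) \<le> (\<integral>\<^sup>+x. ennreal (t x) * indicator A x \<partial>M)"
        unfolding S T using le fL by (intro ennreal_leI) blast
    qed measurable
    then show "AE x in M. (s x)\<^sup>2 \<le> t x"
      by eventually_elim (simp add: t_def ennreal_le_iff)
  qed
  \<comment> \<open>Since b is \<open>F\<close>-measurable, \<open>t\<close> = |b| s. Cancelling one
    factor \<open>s\<close> is harmless: where it is 0 both inequalities hold.\<close>
  have "AE x in M. ((s x)\<^sup>2 \<le> t x) = (enn2real (Esq M F v x) \<le> (cmod (b x))\<^sup>2)"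
    using Esq_mult[of b v, simplified]
  proof eventually_elim
    case (elim x)
    have s0: "s x \<ge> 0" by (simp add: s_def)
    have "t x = cmod (b x) * s x"
      using elim by (simp add: t_def s_def vb_def enn2real_mult real_sqrt_mult mult.commute)
    then have "(s x)\<^sup>2 \<le> t x \<longleftrightarrow> s x * s x \<le> cmod (b x) * s x" by (simp add: power2_eq_square)
    also have "\<dots> \<longleftrightarrow> s x \<le> cmod (b x)"
      using s0 by (cases "s x = 0") (auto simp: mult_le_cancel_right)
    also have "\<dots> \<longleftrightarrow> (s x)\<^sup>2 \<le> (cmod (b x))\<^sup>2"
      using s0 by (simp add: power_mono_iff)
    finally show ?case by (simp add: s_def)
  qed
  then have "(AE x in M. (s x)\<^sup>2 \<le> t x) \<longleftrightarrow> (AE x in M. enn2real (Esq M F v x) \<le> (cmod (b x))\<^sup>2)"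
    by (rule eventually_subst)
  then show ?thesis using A B by (simp add: b_def)
qed

section \<open>The A-class\<close>

text \<open>Test functions cnj u restricted to an \<open>F\<close>-set and to a level set of u:
  for them all conditional expectations are finite.\<close>

lemma condop_bound_imp_Esq_mult_le:
  assumes [measurable]: "u \<in> borel_measurable M" "w \<in> borel_measurable M" and C: "C \<ge> 0"
    and T: "\<And>f. f \<in> L2 M \<Longrightarrow> condop M F u w f \<in> L2 M"
    and bd: "\<And>f. f \<in> L2 M \<Longrightarrow> l2_norm M (condop M F u w f) \<le> C * l2_norm M f"
  shows "AE x in M. Esq M F u x * Esq M F w x \<le> ennreal (C\<^sup>2)"
proof -
  define un where "un n x = (if cmod (u x) \<le> real n then u x else 0)" for n x
  have [measurable]: "un n \<in> borel_measurable M" for n unfolding un_def by measurable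
  have Esq_un: "AE x in M. Esq M F (un n) x \<le> ennreal ((real n)\<^sup>2)" for n
  proof -
    have "AE x in M. Esq M F (un n) x \<le> nn_cond_exp M F (\<lambda>_. ennreal ((real n)\<^sup>2)) x"
      unfolding Esq_def
      by (rule nn_cond_exp_mono) (auto simp: un_def intro!: ennreal_leI power_mono)
    moreover have "AE x in M. ennreal ((real n)\<^sup>2) = nn_cond_exp M F (\<lambda>_. ennreal ((real n)\<^sup>2)) x"
      by (rule nn_cond_exp_F_meas) simp
    ultimately show ?thesis by eventually_elim simp
  qed
  have step: "AE x in M. Esq M F (un n) x * Esq M F w x \<le> ennreal (C\<^sup>2)" for n
  proof -
    define k where "k x = enn2real (Esq M F (un n) x)" for x
    have [measurable]: "k \<in> borel_measurable F" unfolding k_def by measurable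
    have [measurable]: "k \<in> borel_measurable M" by (rule F_measurable_M) fact
    have Ek: "AE x in M. Esq M F (un n) x = ennreal (k x)"
      using Esq_un[of n] by eventually_elim (metis k_def ennreal_enn2real le_less_trans ennreal_less_top)
    have bun: "Esq_bdd M F (\<lambda>x. cnj (un n x))"
      unfolding Esq_bdd_def using Esq_un[of n] by (auto simp: Esq_def intro!: exI[of _ "(real n)\<^sup>2"])
    \<comment> \<open>On the test function \<open>f\<close> below the operator gives w k on
      \<open>A\<close>, so the norm bound compares k^2 E(|w|^2) with C^2 k over \<open>A\<close>.
      Dividing by k comes afterwards, since k may vanish.\<close>
    have "AE x in M. ennreal ((k x)\<^sup>2) * Esq M F w x \<le> ennreal (C\<^sup>2) * Esq M F (un n) x"
    proof (rule AE_le_if_set_nn_integral_le[where c = "C\<^sup>2 * (real n)\<^sup>2"])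
      show "AE x in M. ennreal (C\<^sup>2) * Esq M F (un n) x \<le> ennreal (C\<^sup>2 * (real n)\<^sup>2)"
        using Esq_un[of n] by eventually_elim (simp add: ennreal_mult mult_left_mono)
      fix A assume AF[measurable]: "A \<in> sets F" and fin: "emeasure M A < \<infinity>"
      have AM[measurable]: "A \<in> sets M" using AF subalg by (auto simp: subalgebra_def)
      define h where "h x = complex_of_real (indicator A x)" for x
      have hF[measurable]: "h \<in> borel_measurable F" unfolding h_def by measurable
      have [measurable]: "h \<in> borel_measurable M" by (rule F_measurable_M) fact
      have hA: "ennreal ((cmod (h x))\<^sup>2) = indicator A x" for x by (simp add: h_def indicator_def)
      have hL: "h \<in> L2 M"
        using fin unfolding L2_iff_nn hA by simp
      define f where "f x = cnj (un n x) * h x" for x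
      have fL: "f \<in> L2 M"
        unfolding f_def by (rule Esq_bdd_mult_L2(1)[OF bun _ _ hL hF]) (use Esq_un[of n] in \<open>auto simp: Esq_def\<close>)
      have fn: "ennreal ((l2_norm M f)\<^sup>2) = (\<integral>\<^sup>+x. Esq M F (un n) x * indicator A x \<partial>M)"
      proof -
        have "ennreal ((l2_norm M f)\<^sup>2) = (\<integral>\<^sup>+x. ennreal ((cmod (f x))\<^sup>2) \<partial>M)"
          by (rule L2_nn_integral[OF fL, symmetric])
        also have "\<dots> = (\<integral>\<^sup>+x. indicator A x * ennreal ((cmod (un n x))\<^sup>2) \<partial>M)"
          by (rule nn_integral_cong) (simp add: f_def h_def indicator_def)
        also have "\<dots> = (\<integral>\<^sup>+x. indicator A x * Esq M F (un n) x \<partial>M)"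
          unfolding Esq_def by (rule nn_cond_exp_intg[symmetric]) measurable
        finally show ?thesis by (simp add: mult.commute)
      qed
      \<comment> \<open>\<open>un n\<close> equals u or 0 at each point, so u may be replaced by
        \<open>un n\<close> in the product.\<close>
      have uf: "(\<lambda>y. u y * f y) = (\<lambda>y. of_real (indicator A y) * (un n y * cnj (un n y)))"
        by (auto simp: f_def h_def un_def fun_eq_iff)
      have "AE x in M. cexp M F (\<lambda>y. of_real (indicator A y) * (un n y * cnj (un n y))) x
          = of_real (indicator A x) * cexp M F (\<lambda>y. un n y * cnj (un n y)) x"
        by (rule cexp_mult_real) measurable
      then have Tf: "AE x in M. condop M F u w f x = w x * (of_real (indicator A x) * of_real (k x))"
        using cexp_mult_cnj_self[of "un n", simplified]
        unfolding condop_def uf by eventually_elim (simp add: k_def)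
      have "ennreal ((l2_norm M (condop M F u w f))\<^sup>2) = (\<integral>\<^sup>+x. ennreal ((cmod (condop M F u w f x))\<^sup>2) \<partial>M)"
        by (rule L2_nn_integral[OF T[OF fL], symmetric])
      also have "\<dots> = (\<integral>\<^sup>+x. (indicator A x * ennreal ((k x)\<^sup>2)) * ennreal ((cmod (w x))\<^sup>2) \<partial>M)"
        by (rule nn_integral_cong_AE, use Tf in eventually_elim)
          (simp add: norm_mult power_mult_distrib indicator_def ennreal_mult mult.commute)
      also have "\<dots> = (\<integral>\<^sup>+x. (indicator A x * ennreal ((k x)\<^sup>2)) * Esq M F w x \<partial>M)"
        unfolding Esq_def by (rule nn_cond_exp_intg[symmetric]) measurable
      finally have Tn: "(\<integral>\<^sup>+x. (ennreal ((k x)\<^sup>2) * Esq M F w x) * indicator A x \<partial>M)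
          = ennreal ((l2_norm M (condop M F u w f))\<^sup>2)" by (simp add: mult_ac)
      have "(l2_norm M (condop M F u w f))\<^sup>2 \<le> C\<^sup>2 * (l2_norm M f)\<^sup>2"
        using power_mono[OF bd[OF fL], of 2] by (simp add: power_mult_distrib)
      then have "ennreal ((l2_norm M (condop M F u w f))\<^sup>2) \<le> ennreal (C\<^sup>2) * ennreal ((l2_norm M f)\<^sup>2)"
        by (simp add: ennreal_mult[symmetric] ennreal_leI)
      also have "\<dots> = (\<integral>\<^sup>+x. ennreal (C\<^sup>2) * (Esq M F (un n) x * indicator A x) \<partial>M)"
        unfolding fn by (rule nn_integral_cmult[symmetric]) measurable
      finally show "(\<integral>\<^sup>+x. (ennreal ((k x)\<^sup>2) * Esq M F w x) * indicator A x \<partial>M)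
          \<le> (\<integral>\<^sup>+x. (ennreal (C\<^sup>2) * Esq M F (un n) x) * indicator A x \<partial>M)"
        unfolding Tn by (simp add: mult.assoc)
    qed measurable
    with Ek show ?thesis
    proof eventually_elim
      case (elim x)
      show ?case
      proof (cases "k x = 0")
        case True
        then show ?thesis using elim(1) by simp
      next
        case False
        then have k: "k x > 0" using enn2real_nonneg[of "Esq M F (un n) x"] by (simp add: k_def less_le)
        have "ennreal (k x) * (ennreal (k x) * Esq M F w x) \<le> ennreal (k x) * ennreal (C\<^sup>2)"
          using elim k by (simp add: power2_eq_square ennreal_mult mult_ac)
        then show ?thesis using k unfolding elim(1) by (simp add: ennreal_mult_le_mult_iff)
      qed
    qed
  qed
  show ?thesis
  proof (rule AE_le_if_set_nn_integral_le[where c = "C\<^sup>2"])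
    fix A assume AF[measurable]: "A \<in> sets F"
    have AM[measurable]: "A \<in> sets M" using AF subalg by (auto simp: subalgebra_def)
    let ?c = "\<lambda>x. Esq M F w x * indicator A x"
    have "(\<integral>\<^sup>+x. Esq M F u x * Esq M F w x * indicator A x \<partial>M) = (\<integral>\<^sup>+x. ?c x * Esq M F u x \<partial>M)"
      by (simp add: mult_ac)
    also have "\<dots> = (\<integral>\<^sup>+x. ?c x * ennreal ((cmod (u x))\<^sup>2) \<partial>M)"
      unfolding Esq_def[of M F u] by (rule nn_cond_exp_intg) measurable
    \<comment> \<open>The supremum is attained: \<open>un n x = u x\<close> as soon as
      \<open>n\<close> is at least |u x|.\<close>
    also have "\<dots> \<le> (\<integral>\<^sup>+x. (SUP n. ?c x * ennreal ((cmod (un n x))\<^sup>2)) \<partial>M)"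
    proof (rule nn_integral_mono)
      fix x
      have "?c x * ennreal ((cmod (u x))\<^sup>2) = ?c x * ennreal ((cmod (un (nat \<lceil>cmod (u x)\<rceil>) x))\<^sup>2)"
        by (simp add: un_def)
      also have "\<dots> \<le> (SUP n. ?c x * ennreal ((cmod (un n x))\<^sup>2))" by (rule SUP_upper) simp
      finally show "?c x * ennreal ((cmod (u x))\<^sup>2) \<le> (SUP n. ?c x * ennreal ((cmod (un n x))\<^sup>2))" .
    qed
    also have "\<dots> = (SUP n. \<integral>\<^sup>+x. ?c x * ennreal ((cmod (un n x))\<^sup>2) \<partial>M)"
    proof (rule nn_integral_monotone_convergence_SUP)
      show "incseq (\<lambda>n x. ?c x * ennreal ((cmod (un n x))\<^sup>2))"
        by (intro incseq_SucI le_funI mult_left_mono ennreal_leI) (auto simp: un_def)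
    qed measurable
    also have "\<dots> \<le> (\<integral>\<^sup>+x. ennreal (C\<^sup>2) * indicator A x \<partial>M)"
    proof (rule SUP_least)
      fix n
      have "(\<integral>\<^sup>+x. ?c x * ennreal ((cmod (un n x))\<^sup>2) \<partial>M) = (\<integral>\<^sup>+x. ?c x * Esq M F (un n) x \<partial>M)"
        unfolding Esq_def[of M F "un n"] by (rule nn_cond_exp_intg[symmetric]) measurable
      also have "\<dots> \<le> (\<integral>\<^sup>+x. ennreal (C\<^sup>2) * indicator A x \<partial>M)"
        by (rule nn_integral_mono_AE, use step[of n] in eventually_elim) (auto simp: indicator_def mult.commute)
      finally show "(\<integral>\<^sup>+x. ?c x * ennreal ((cmod (un n x))\<^sup>2) \<partial>M) \<le> \<dots>" .
    qed
    finally show "(\<integral>\<^sup>+x. Esq M F u x * Esq M F w x * indicator A x \<partial>M) \<le> (\<integral>\<^sup>+x. ennreal (C\<^sup>2) * indicator A x \<partial>M)" .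
  qed simp_all
qed

text \<open>The inequality is stated in \<open>ennreal\<close> because either conditional square may
  be infinite on a set of positive measure; boundedness makes the other one vanish there, and then
  the product is 0.\<close>

lemma condop_A_class_iff:
  assumes u[measurable]: "u \<in> borel_measurable M" and w[measurable]: "w \<in> borel_measurable M"
    and T: "bounded_op M (condop M F u w)"
  shows "A_class M (condop M F u w) \<longleftrightarrow>
    (AE x in M. Esq M F u x * Esq M F w x \<le> ennreal ((cmod (cexp M F (\<lambda>y. u y * w y) x))\<^sup>2))"
proof -
  obtain C where C: "C \<ge> 0" "\<And>f. f \<in> L2 M \<Longrightarrow> l2_norm M (condop M F u w f) \<le> C * l2_norm M f"
    by (rule bounded_op_norm[OF T]) blast
  have KL: "AE x in M. Esq M F u x * Esq M F w x \<le> ennreal (C\<^sup>2)"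
    by (rule condop_bound_imp_Esq_mult_le[OF u w C(1) bounded_op_L2[OF T] C(2)])
  \<comment> \<open>\<^term>\<open>k\<close>, and with it both \<^term>\<open>s\<close> and \<^term>\<open>r\<close>, is 0 also where \<^term>\<open>Esq M F u x\<close> is infinite;
    there \<^term>\<open>Esq M F w x\<close> vanishes by \<open>KL\<close>.\<close>
  define k where "k x = enn2real (Esq M F u x)" for x
  define s r where "s x = sqrt (k x)" and "r x = 1 / sqrt (k x)" for x
  have [measurable]: "k \<in> borel_measurable F" unfolding k_def by measurable
  have [measurable]: "s \<in> borel_measurable F" "r \<in> borel_measurable F" unfolding s_def r_def by measurable
  have [measurable]: "s \<in> borel_measurable M" "r \<in> borel_measurable M" by (auto intro: F_measurable_M)
  have k0: "k x \<ge> 0" for x by (simp add: k_def)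
  define e where "e x = cnj (u x) * of_real (r x)" for x
  define v where "v x = w x * of_real (s x)" for x
  have [measurable]: "e \<in> borel_measurable M" "v \<in> borel_measurable M" unfolding e_def v_def by measurable
  have Ee: "AE x in M. Esq M F e x = (if k x = 0 then 0 else 1)"
  proof -
    have "AE x in M. Esq M F (\<lambda>x. cnj (u x) * of_real (r x)) x
        = ennreal ((cmod (of_real (r x)))\<^sup>2) * Esq M F (\<lambda>x. cnj (u x)) x"
      by (rule Esq_mult) measurable
    then show ?thesis
    proof eventually_elim
      case (elim x)
      have eq: "Esq M F e x = ennreal ((r x)\<^sup>2) * Esq M F u x"
        using elim by (simp add: e_def[abs_def] Esq_def)
      show ?case
      proof (cases "k x = 0")
        case True
        then show ?thesis unfolding eq by (simp add: r_def)
      next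
        case False
        then have kx: "k x > 0" using k0[of x] by simp
        then have "Esq M F u x = ennreal (k x)"
          unfolding k_def by (cases "Esq M F u x = \<infinity>") (auto simp: less_top)
        then have "Esq M F e x = ennreal ((r x)\<^sup>2 * k x)" unfolding eq using kx by (simp add: ennreal_mult)
        also have "(r x)\<^sup>2 * k x = 1" using kx by (simp add: r_def power_divide)
        finally show ?thesis using False by simp
      qed
    qed
  qed
  have Ev: "AE x in M. Esq M F v x = ennreal (k x) * Esq M F w x"
  proof -
    have "AE x in M. Esq M F (\<lambda>x. w x * of_real (s x)) x = ennreal ((cmod (of_real (s x)))\<^sup>2) * Esq M F w x"
      by (rule Esq_mult) measurable
    then show ?thesis by eventually_elim (simp add: v_def[abs_def] s_def k0)
  qed
  have KLv: "AE x in M. Esq M F u x * Esq M F w x = Esq M F v x"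
    using Ev KL
  proof eventually_elim
    case (elim x)
    show ?case
    proof (cases "Esq M F u x = \<infinity>")
      case True
      then have "Esq M F w x = 0" using elim(2) by (cases "Esq M F w x = 0") (auto simp: ennreal_top_mult top_unique)
      then show ?thesis using elim(1) by simp
    next
      case False
      then have "Esq M F u x = ennreal (k x)" by (simp add: k_def less_top)
      then show ?thesis using elim(1) by simp
    qed
  qed
  have e: "Esq_bdd M F e"
    unfolding Esq_bdd_def
    by (intro conjI exI[of _ 1]) (use Ee in \<open>auto elim!: eventually_mono\<close>)
  have v: "Esq_bdd M F v"
    unfolding Esq_bdd_def
  proof (intro conjI exI[of _ "C\<^sup>2"])
    show "AE x in M. Esq M F v x \<le> ennreal (C\<^sup>2)" using KLv KL by eventually_elim simp
  qed auto
  have e1: "AE x in M. e x \<noteq> 0 \<longrightarrow> Esq M F e x = 1"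
    using Ee by eventually_elim (auto simp: e_def r_def)
  have v1: "AE x in M. Esq M F v x \<noteq> 0 \<longrightarrow> Esq M F e x = 1"
    using Ee Ev by eventually_elim auto
  have eq: "op_eq M (condop M F u w) (rank_op M F v e)"
    unfolding op_eq_def
  proof
    fix f assume f: "f \<in> L2 M"
    have [measurable]: "f \<in> borel_measurable M" by (rule L2_measurable[OF f])
    have "AE x in M. cexp M F (\<lambda>y. of_real (r y) * (u y * f y)) x = of_real (r x) * cexp M F (\<lambda>y. u y * f y) x"
      by (rule cexp_mult_real) measurable
    moreover have "AE x in M. Esq M F u x = 0 \<longrightarrow> cexp M F (\<lambda>y. u y * f y) x = 0"
      using Esq_eq_0_imp[OF u] by (intro cexp_eq_0_on) (auto elim!: eventually_mono)
    ultimately show "AE x in M. condop M F u w f x = rank_op M F v e f x"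
      using Esq_eq_0_imp[OF w] KL
    proof eventually_elim
      case (elim x)
      have R: "rank_op M F v e f x = w x * of_real (s x * r x) * cexp M F (\<lambda>y. u y * f y) x"
        using elim(1) by (simp add: rank_op_def v_def e_def mult_ac)
      \<comment> \<open>The product \<open>s x * r x\<close> is 1 where \<open>k x\<close> is
        nonzero, and 0 otherwise because 1/0 = 0. In the second case the original operator also
        gives 0: either E(|u|^2) = 0 kills E(u f), or E(|u|^2) is infinite and \<open>KL\<close>
        forces w to vanish.\<close>
      show ?case
      proof (cases "k x = 0")
        case False
        then have "s x * r x = 1" by (simp add: s_def r_def)
        then show ?thesis unfolding R by (simp add: condop_def)
      next
        case True
        then consider "Esq M F u x = 0" | "Esq M F u x = \<infinity>"
          by (auto simp: k_def enn2real_eq_0_iff)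
        then have "w x = 0 \<or> cexp M F (\<lambda>y. u y * f y) x = 0"
        proof cases
          case 1
          then show ?thesis using elim(2) by simp
        next
          case 2
          then have "Esq M F w x = 0" using elim(4)
            by (cases "Esq M F w x = 0") (auto simp: ennreal_top_mult top_unique)
          then show ?thesis using elim(3) by simp
        qed
        then show ?thesis unfolding R by (auto simp: condop_def)
      qed
    qed
  qed
  have "AE x in M. cexp M F (\<lambda>y. of_real (s y * r y) * (u y * w y)) x = of_real (s x * r x) * cexp M F (\<lambda>y. u y * w y) x"
    by (rule cexp_mult_real) measurable
  then have "AE x in M. (enn2real (Esq M F v x) \<le> (cmod (cexp M F (\<lambda>y. v y * cnj (e y)) x))\<^sup>2)
      = (Esq M F u x * Esq M F w x \<le> ennreal ((cmod (cexp M F (\<lambda>y. u y * w y) x))\<^sup>2))"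
    using KLv Ev Esq_bdd_finite[OF v]
  proof eventually_elim
    case (elim x)
    have b: "cexp M F (\<lambda>y. v y * cnj (e y)) x = of_real (s x * r x) * cexp M F (\<lambda>y. u y * w y) x"
      using elim(1) by (simp add: v_def e_def mult_ac)
    have Ev': "Esq M F v x = ennreal (enn2real (Esq M F v x))" using elim(4) by (simp add: less_top)
    show ?case
    \<comment> \<open>Where \<open>k x = 0\<close> the product of the conditional squares is 0 and
      both inequalities hold, whatever E(u w) is.\<close>
    proof (cases "k x = 0")
      case True
      then have "Esq M F v x = 0" using elim(3) by simp
      then show ?thesis unfolding elim(2) by simp
    next
      case False
      then have "s x * r x = 1" by (simp add: s_def r_def)
      then have "cexp M F (\<lambda>y. v y * cnj (e y)) x = cexp M F (\<lambda>y. u y * w y) x" using b by simp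
      moreover have "(Esq M F v x \<le> ennreal c) = (enn2real (Esq M F v x) \<le> c)" if "c \<ge> 0" for c
        using that by (subst Ev') (simp add: ennreal_le_iff)
      ultimately show ?thesis unfolding elim(2) by simp
    qed
  qed
  then show ?thesis
    unfolding rank_op_A_class_iff[OF v e T eq e1 v1] by (rule eventually_subst)
qed

end

theorem theorem2p6:
  fixes M F :: "'a measure" and u w :: "'a \<Rightarrow> complex"
  assumes "complete_measure M"
    and "sigma_finite_measure M"
    and "sigma_finite_subalgebra M F"
    and "u \<in> domE M F" and "w \<in> domE M F"
    and "bounded_op M (condop M F u w)"
  shows
   "((AE x in M. Esq M F u x \<noteq> 0 \<longrightarrow>
        ennreal ((cmod (cexp M F (\<lambda>y. u y * w y) x))\<^sup>2) \<ge> Esq M F u x * Esq M F w x)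
       \<longrightarrow> A_class M (condop M F u w))
    \<and> (A_class M (condop M F u w) \<longrightarrow>
       (AE x in M. cexp M F u x \<noteq> 0 \<longrightarrow>
        ennreal ((cmod (cexp M F (\<lambda>y. u y * w y) x))\<^sup>2) \<ge> Esq M F u x * Esq M F w x))
    \<and> ((AE x in M. Esq M F u x \<noteq> 0 \<longleftrightarrow> cexp M F u x \<noteq> 0) \<longrightarrow>
       (A_class M (condop M F u w) \<longleftrightarrow>
        (AE x in M. Esq M F u x \<noteq> 0 \<longrightarrow>
          ennreal ((cmod (cexp M F (\<lambda>y. u y * w y) x))\<^sup>2) \<ge> Esq M F u x * Esq M F w x)))"
proof -
  interpret sigma_finite_subalgebra M F by fact
  have "A_class M (condop M F u w) \<longleftrightarrow>
    (AE x in M. Esq M F u x * Esq M F w x \<le> ennreal ((cmod (cexp M F (\<lambda>y. u y * w y) x))\<^sup>2))"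
    using assms(4-6) by (intro condop_A_class_iff domE_measurable)
  also have "\<dots> \<longleftrightarrow> (AE x in M. Esq M F u x \<noteq> 0 \<longrightarrow>
      Esq M F u x * Esq M F w x \<le> ennreal ((cmod (cexp M F (\<lambda>y. u y * w y) x))\<^sup>2))"
    \<comment> \<open>The guard is free: off the support of E(|u|^2) the left side is 0, also when
      E(|w|^2) is infinite, since 0 times infinity is 0 in \<open>ennreal\<close>.\<close>
    by (intro arg_cong[where f = "\<lambda>P. eventually P (ae_filter M)"]) (auto simp: fun_eq_iff)
  finally have iff: "A_class M (condop M F u w) \<longleftrightarrow> \<dots>" .
  \<comment> \<open>For the same reason the inequality on S already holds almost everywhere, so
    restricting it to the support of E u only weakens it.\<close>
  have "AE x in M. cexp M F u x \<noteq> 0 \<longrightarrow>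
      Esq M F u x * Esq M F w x \<le> ennreal ((cmod (cexp M F (\<lambda>y. u y * w y) x))\<^sup>2)"
    if "AE x in M. Esq M F u x \<noteq> 0 \<longrightarrow>
      Esq M F u x * Esq M F w x \<le> ennreal ((cmod (cexp M F (\<lambda>y. u y * w y) x))\<^sup>2)"
    using that by eventually_elim (metis mult_zero_left zero_le)
  then show ?thesis using iff by blast
qed

end
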